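(* Let $p$ be an odd prime with $p\equiv 3 \pmod 4$, $n$ an odd positive integer, $q=p^n$, $N=\frac{p^n-1}{2}$, $\alpha$ a primitive element of $\mathbb{F}_q$, $\beta\in\mathbb{F}_q^*$, and $m(t)={\rm Tr}_1^n(\beta\alpha^t)$. Let $d=N+1$ and $$S=\{\,m(2t+i)+m(d(t+l)+j)\;:\;0\le i,j\le 1,\ 0\le l\le N-1\,\}.$$ For $i_1,i_2,j_1,j_2\in\{0,1\}$ and $l_1,l_2,\tau\in\{0,\dots,N-1\}$, the correlation $C(\tau)$ between the sequences $m(2t+i_1)+m(d(t+l_1)+j_1)$ and $m(2t+i_2)+m(d(t+l_2)+j_2)$ of $S$ is $$C(\tau)=\sum_{t=0}^{N-1}\omega^{{\rm Tr}_1^n(a\alpha^{2t}+b\alpha^{(N+1)t})},\qquad a=\beta(\alpha^{i_1}-\alpha^{2\tau+i_2}),\quad b=\beta(\alpha^{dl_1+j_1}-\alpha^{d\tau+dl_2+j_2}),$$ and, over all such choices of parameters except the trivial autocorrelation case ($\tau=0$, $i_1=i_2$, $j_1=j_2$, $l_1=l_2$), the maximum magnitude $C_{\rm max}$ of $C(\tau)$ satisfies $$C_{\rm max}\le \frac{3}{\sqrt{2}}\sqrt{N+\frac12}+\frac12 .$$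
   Context: Here ${\rm Tr}_1^n(x)=\sum_{k=0}^{n-1}x^{p^k}$ is the trace function from $\mathbb{F}_q$ to $\mathbb{F}_p$, and $\omega=e^{2\pi\sqrt{-1}/p}$. The sequence $m(t)$ is a $p$-ary m-sequence of period $q-1$; an element of $S$ is a $p$-ary sequence indexed by $t$ (for fixed $i,j,l$), with $s(t+N)=s(t)$ for all $t$. For two $p$-ary sequences $s_1,s_2$ of period $N$, their correlation at shift $\tau$ is $C_{s_1,s_2}(\tau)=\sum_{t=0}^{N-1}\omega^{s_1(t)-s_2(t+\tau)}$. *)

theory Defs
  imports Complex_Main "HOL-Number_Theory.Cong" "HOL-Computational_Algebra.Primes"
begin

text \<open>
  The field with \<open>q = p^n\<close> elements is a type \<open>'a\<close> of sort \<open>{field, finite}\<close> with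
  \<open>card (UNIV :: 'a set) = p^n\<close>. The prime field is identified with the image of \<^const>\<open>of_nat\<close> in \<open>'a\<close>,
  so \<open>p\<close>-ary sequences are functions from \<^typ>\<open>nat\<close> to \<open>'a\<close> taking values in that image.
\<close>

definition primitive_element :: "'a::field \<Rightarrow> bool" where
  "primitive_element \<alpha> \<longleftrightarrow> range (\<lambda>k::nat. \<alpha> ^ k) = UNIV - {0}"

definition Tr :: "nat \<Rightarrow> nat \<Rightarrow> 'a::field \<Rightarrow> 'a" where
  "Tr p n x = (\<Sum>k<n. x ^ (p ^ k))"

definition omega :: "nat \<Rightarrow> complex" where
  "omega p = exp (2 * of_real pi * \<i> / of_nat p)"

text \<open>
  A power of \<open>\<omega>\<close> with exponent in the prime field: the exponent is replaced by its
  representative in \<open>{0..<p}\<close>. Outside the prime field the value is unspecified.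
\<close>

definition omega_pow :: "nat \<Rightarrow> 'a::field \<Rightarrow> complex" where
  "omega_pow p x = omega p ^ (THE k. k < p \<and> of_nat k = x)"

definition correlation ::
    "nat \<Rightarrow> nat \<Rightarrow> (nat \<Rightarrow> 'a::field) \<Rightarrow> (nat \<Rightarrow> 'a) \<Rightarrow> nat \<Rightarrow> complex" where
  "correlation p N s1 s2 \<tau> = (\<Sum>t<N. omega_pow p (s1 t - s2 (t + \<tau>)))"

definition m_seq :: "nat \<Rightarrow> nat \<Rightarrow> 'a::field \<Rightarrow> 'a \<Rightarrow> nat \<Rightarrow> 'a" where
  "m_seq p n \<beta> \<alpha> t = Tr p n (\<beta> * \<alpha> ^ t)"

definition half_period :: "nat \<Rightarrow> nat \<Rightarrow> nat" where
  "half_period p n = (p ^ n - 1) div 2"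

definition S_seq ::
    "nat \<Rightarrow> nat \<Rightarrow> 'a::field \<Rightarrow> 'a \<Rightarrow> nat \<Rightarrow> nat \<Rightarrow> nat \<Rightarrow> nat \<Rightarrow> 'a" where
  "S_seq p n \<beta> \<alpha> i j l =
     (\<lambda>t. m_seq p n \<beta> \<alpha> (2 * t + i) + m_seq p n \<beta> \<alpha> ((half_period p n + 1) * (t + l) + j))"

definition S_family :: "nat \<Rightarrow> nat \<Rightarrow> 'a::field \<Rightarrow> 'a \<Rightarrow> (nat \<Rightarrow> 'a) set" where
  "S_family p n \<beta> \<alpha> = {S_seq p n \<beta> \<alpha> i j l | i j l. i \<le> 1 \<and> j \<le> 1 \<and> l < half_period p n}"

text \<open>
  The set below is finite, and it is nonempty whenever \<open>half_period p n > 0\<close>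
  (take \<open>i1 \<noteq> i2\<close>), so \<^const>\<open>Max\<close> is a genuine maximum.
\<close>

definition C_max :: "nat \<Rightarrow> nat \<Rightarrow> 'a::field \<Rightarrow> 'a \<Rightarrow> real" where
  "C_max p n \<beta> \<alpha> =
     Max {cmod (correlation p (half_period p n) (S_seq p n \<beta> \<alpha> i1 j1 l1) (S_seq p n \<beta> \<alpha> i2 j2 l2) \<tau>)
          | i1 i2 j1 j2 l1 l2 \<tau>.
            i1 \<le> 1 \<and> i2 \<le> 1 \<and> j1 \<le> 1 \<and> j2 \<le> 1 \<and>
            l1 < half_period p n \<and> l2 < half_period p n \<and> \<tau> < half_period p n \<and>
            \<not> (\<tau> = 0 \<and> i1 = i2 \<and> j1 = j2 \<and> l1 = l2)}"

end

theory Submission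
  imports Defs "HOL-Algebra.Algebraic_Closure_Type" "HOL-Number_Theory.Residues" "HOL-Analysis.Analysis"
begin

hide_const (open) Polynomials.degree Polynomials.lead_coeff up_ring.coeff up_ring.monom Coset.order Divisibility.prime

text \<open>
  Since \<open>q \<equiv> 3 (mod 4)\<close>, the element \<open>-\<alpha>\<close> generates the squares, so that
  \<open>2 C(\<tau>) + 1\<close> is the complete sum of \<open>\<psi>(a y^4 + b y^2)\<close> over \<open>y\<close> in \<open>F_q\<close>, where
  \<open>\<psi> = \<omega>^Tr\<close> and \<open>(a, b) \<noteq> (0, 0)\<close>. The claim is the Weil bound \<open>3 sqrt q\<close> for this sum.
  Its L-function is a polynomial of degree at most 3, hence there are \<open>w1, w2, w3\<close> such that the
  corresponding sums over all extensions \<open>F_{q^m}\<close> are \<open>-(w1^m + w2^m + w3^m)\<close>. An estimate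
  \<open>O(q^(m/2))\<close> for all large even \<open>m\<close> then forces \<open>|w_i| \<le> sqrt q\<close>. This estimate comes from Bombieri's version
  of Stepanov's argument: on the curve \<open>z^q - z = a x^4 + b x^2\<close> one constructs a nonzero function
  with a pole of small order at infinity that vanishes at all points to be counted.
\<close>

section \<open>Finite subfields of an algebraically closed field\<close>

text \<open>Even \<open>m = 2 * r\<close> is what makes the vanishing argument work. Put R = q^r. At
  a point of the curve over \<open>x \<in> Fix m\<close>, raising to the power q^m = R^2 fixes x and
  sends z to z + \<gamma>, where \<gamma> is the trace of f(x) in F_q. Counting coefficients
  produces functions \<open>U v\<close>, not all zero, such that the sum of
  \<open>U v ^ R * mon v (x, z + \<gamma>)\<close> is zero on the whole curve. Over the points with
  trace \<gamma> this sum is the R-th power of H, the sum of \<open>U v * mon v ^ R\<close>, so H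
  vanishes there. The relation is trivial on the curve but H is not, because its nonzero summands
  have distinct pole orders. This bounds each trace fiber from above only; lower bounds need all
  fibers together. The crude constant is harmless: a fixed multiple of sqrt(q^m) for all large even
  m already bounds each |w_i|, and only the number 3 of these survives in the final
  estimate.\<close>

lemma card_roots_separable:
  fixes P :: "'k::alg_closed_field poly"
  assumes "P \<noteq> 0" and sep: "\<And>x. poly P x = 0 \<Longrightarrow> poly (pderiv P) x \<noteq> 0"
  shows "card {x. poly P x = 0} = degree P"
proof -
  obtain A where A: "size A = degree P" "P = smult (lead_coeff P) (\<Prod>x\<in>#A. [:-x, 1:])"
    using alg_closed_imp_factorization[OF assms(1)] by blast
  have poly_eq: "poly P x = lead_coeff P * (\<Prod>y\<in>#A. x - y)" for x
    by (subst A(2)) (simp add: poly_prod_mset)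
  have roots: "{x. poly P x = 0} = set_mset A"
    using assms(1) by (auto simp: poly_eq prod_mset_zero_iff)
  \<comment> \<open>A root of multiplicity at least two would also be a root of the
    derivative.\<close>
  have "count A x \<le> 1" for x
  proof (rule ccontr)
    assume "\<not> count A x \<le> 1"
    hence "{#x, x#} \<subseteq># A"
      by (auto simp: subseteq_mset_def)
    then obtain B where B: "A = {#x, x#} + B"
      by (metis mset_subset_eq_exists_conv)
    define G where "G = (\<Prod>y\<in>#B. [:-y, 1:])"
    have "P = smult (lead_coeff P) ([:-x, 1:] * ([:-x, 1:] * G))"
      by (subst A(2)) (simp add: B G_def)
    hence "pderiv P = pderiv (smult (lead_coeff P) ([:-x, 1:] * ([:-x, 1:] * G)))"
      by simp
    also have "poly \<dots> x = 0"
      by (simp only: pderiv_smult pderiv_mult poly_smult poly_add poly_mult) simp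
    finally have "poly (pderiv P) x = 0" .
    moreover have "x \<in># A" by (simp add: B)
    ultimately show False using sep roots by auto
  qed
  hence "count A x = 1" if "x \<in># A" for x
    using that by (metis count_eq_zero_iff le_neq_implies_less less_one)
  hence "size A = card (set_mset A)"
    by (simp add: size_multiset_overloaded_eq)
  thus ?thesis by (simp add: roots A(1))
qed

text \<open>\<open>f_frob\<close> places the coefficients of \<open>f\<close> in F_q. Coprimality of
  \<open>degree f\<close> and q separates the pole orders of the reduced monomials
  (\<open>inj_wt\<close>); geometrically, the point at infinity is totally ramified over the
  x-line.\<close>

locale artin_schreier =
  fixes q n :: nat and f :: "'k::alg_closed_field poly"
  assumes prime_CHAR: "prime CHAR('k)"
    and q_eq: "q = CHAR('k) ^ n" and n_pos: "n > 0"
    and f_frob: "\<And>i. coeff f i ^ q = coeff f i"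
    and degree_f_pos: "degree f > 0"
    and coprime_degree: "coprime (degree f) q"
begin

text \<open>For m > 0 this is the field with q^m elements. Taking all extensions of F_q inside one
  algebraically closed field keeps the tower in a single type. For m = 0 it is the whole field,
  hence the conditions m > 0 below.\<close>

definition Fix :: "nat \<Rightarrow> 'k set" where
  "Fix m = {x. x ^ (q ^ m) = x}"

lemma q_ge_2: "q \<ge> 2"
proof -
  have "CHAR('k) ^ 1 \<le> CHAR('k) ^ n"
    using n_pos prime_ge_1_nat[OF prime_CHAR] by (intro power_increasing) auto
  thus ?thesis using prime_ge_2_nat[OF prime_CHAR] q_eq by simp
qed

lemma q_gt_0 [simp]: "q > 0"
  using q_ge_2 by linarith

lemma q_neq_0 [simp]: "q \<noteq> 0"
  using q_gt_0 by linarith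

lemma q_power_gt_0: "q ^ m > 0"
  using q_ge_2 by (intro zero_less_power) linarith

lemma q_power_eq: "q ^ m = CHAR('k) ^ (n * m)"
  by (simp add: q_eq power_mult)

lemma frob_add: "(x + y :: 'k) ^ (q ^ m) = x ^ (q ^ m) + y ^ (q ^ m)"
  by (rule freshmans_dream'[OF prime_CHAR q_power_eq])

lemma frob_sum: "(\<Sum>i\<in>A. g i :: 'k) ^ (q ^ m) = (\<Sum>i\<in>A. g i ^ (q ^ m))"
  by (rule freshmans_dream_sum'[OF prime_CHAR q_power_eq])

lemma frob_minus: "(- x :: 'k) ^ (q ^ m) = - (x ^ (q ^ m))"
  using frob_add[of x "-x" m] by (simp add: zero_power eq_neg_iff_add_eq_0 add.commute)

lemma frob_diff: "(x - y :: 'k) ^ (q ^ m) = x ^ (q ^ m) - y ^ (q ^ m)"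
  using frob_add[of x "-y" m] by (simp add: frob_minus)

lemma frob_add_q: "(x + y :: 'k) ^ q = x ^ q + y ^ q"
  and frob_sum_q: "(\<Sum>i\<in>A. g i :: 'k) ^ q = (\<Sum>i\<in>A. g i ^ q)"
  using frob_add[of x y 1] frob_sum[of g A 1] by simp_all

lemma frob_inj: "x ^ (q ^ m) = y ^ (q ^ m) \<Longrightarrow> x = (y::'k)"
  using frob_diff[of x y m] by simp

lemma Fix_0 [simp]: "0 \<in> Fix m" and Fix_1 [simp]: "1 \<in> Fix m"
  by (auto simp: Fix_def zero_power)

lemma Fix_add [intro]: "x \<in> Fix m \<Longrightarrow> y \<in> Fix m \<Longrightarrow> x + y \<in> Fix m"
  by (simp add: Fix_def frob_add)
lemma Fix_diff [intro]: "x \<in> Fix m \<Longrightarrow> y \<in> Fix m \<Longrightarrow> x - y \<in> Fix m"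
  by (simp add: Fix_def frob_diff)
lemma Fix_minus [intro]: "x \<in> Fix m \<Longrightarrow> - x \<in> Fix m"
  by (simp add: Fix_def frob_minus)
lemma Fix_mult [intro]: "x \<in> Fix m \<Longrightarrow> y \<in> Fix m \<Longrightarrow> x * y \<in> Fix m"
  by (simp add: Fix_def power_mult_distrib)
lemma Fix_power [intro]: "x \<in> Fix m \<Longrightarrow> x ^ k \<in> Fix m"
  by (induction k) auto
lemma Fix_sum [intro]: "(\<And>i. i \<in> A \<Longrightarrow> g i \<in> Fix m) \<Longrightarrow> sum g A \<in> Fix m"
  by (induction A rule: infinite_finite_induct) auto
lemma Fix_numeral [simp]: "of_nat k \<in> Fix m" "numeral w \<in> Fix m"
proof -
  show *: "of_nat k \<in> Fix m" for k by (induction k) auto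
  from *[of "numeral w"] show "numeral w \<in> Fix m" by simp
qed

lemma Fix_1_iff: "x \<in> Fix 1 \<longleftrightarrow> x ^ q = x"
  by (simp add: Fix_def)

lemma Fix_mult_exponent: "x \<in> Fix m \<Longrightarrow> x \<in> Fix (m * k)"
proof (induction k)
  case (Suc k)
  have "x ^ (q ^ (m * Suc k)) = (x ^ (q ^ m)) ^ (q ^ (m * k))"
    by (simp add: power_add flip: power_mult)
  thus ?case using Suc by (simp add: Fix_def)
qed (simp add: Fix_def)

lemma Fix_1_subset: "x \<in> Fix 1 \<Longrightarrow> x \<in> Fix m"
  using Fix_mult_exponent[of x 1 m] by simp

lemma coeff_f_Fix: "coeff f i \<in> Fix m"
proof (rule Fix_1_subset)
  show "coeff f i \<in> Fix 1" unfolding Fix_1_iff by (rule f_frob)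
qed

lemma of_nat_q_power: "m > 0 \<Longrightarrow> of_nat (q ^ m) = (0 :: 'k)"
  using n_pos by (simp add: q_eq zero_power)

text \<open>The derivative of X^(q^m) - X is the constant -1, so this polynomial has as many roots
  as its degree.\<close>

lemma card_Fix:
  assumes "m > 0"
  shows "card (Fix m) = q ^ m"
proof -
  let ?P = "monom 1 (q ^ m) - [:0, 1:] :: 'k poly"
  have "q ^ m \<ge> 2 ^ m" using q_ge_2 by (intro power_mono) auto
  moreover have "(2::nat) ^ m \<ge> 2 ^ 1" using assms by (intro power_increasing) auto
  ultimately have qm: "q ^ m > 1" by simp
  have deg: "degree ?P = q ^ m"
  proof -
    have "degree (monom (1::'k) (q ^ m) + - [:0, 1:]) = degree (monom (1::'k) (q ^ m))"
      by (rule degree_add_eq_left) (use qm in \<open>auto simp: degree_monom_eq\<close>)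
    thus ?thesis by (simp only: add_uminus_conv_diff degree_monom_eq) (simp add: degree_monom_eq)
  qed
  have "card {x. poly ?P x = 0} = degree ?P"
  proof (rule card_roots_separable)
    show "?P \<noteq> 0" using deg qm degree_0 not_less0 by metis
    fix x :: 'k
    have "pderiv ?P = [:- 1:]"
      using of_nat_q_power[OF assms] by (simp add: pderiv_diff pderiv_monom pderiv_pCons del: of_nat_power)
    thus "poly (pderiv ?P) x \<noteq> 0" by simp
  qed
  moreover have "{x. poly ?P x = 0} = Fix m"
    by (auto simp: Fix_def poly_monom)
  ultimately show ?thesis using deg by simp
qed

lemma finite_Fix: "m > 0 \<Longrightarrow> finite (Fix m)"
  using card_Fix[of m] q_power_gt_0[of m] card_ge_0_finite by metis

text \<open>On \<open>Fix m\<close> this is the relative trace to F_q = \<open>Fix 1\<close>. The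
  absolute trace \<open>Tr\<close> to the prime field enters only later, through the choice of
  \<psi>.\<close>

definition trace :: "nat \<Rightarrow> 'k \<Rightarrow> 'k" where
  "trace m x = (\<Sum>i<m. x ^ (q ^ i))"

lemma trace_power_q:
  assumes "x \<in> Fix m"
  shows "trace m x ^ q = trace m x"
proof -
  have "trace m x ^ q = (\<Sum>i<m. x ^ (q ^ Suc i))"
    by (simp add: trace_def frob_sum_q flip: power_mult) (simp add: mult.commute)
  also have "\<dots> + x = (\<Sum>i<Suc m. x ^ (q ^ i))"
    by (subst sum.lessThan_Suc_shift) simp
  also have "\<dots> = trace m x + x"
    using assms by (simp add: trace_def Fix_def)
  finally show ?thesis by simp
qed

lemma trace_Fix: "x \<in> Fix m \<Longrightarrow> trace m x \<in> Fix 1"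
  unfolding Fix_1_iff by (rule trace_power_q)

lemma poly_f_Fix: "x \<in> Fix m \<Longrightarrow> poly f x \<in> Fix m"
  unfolding poly_altdef by (intro Fix_sum Fix_mult coeff_f_Fix Fix_power)

lemma poly_f_frob: "poly f (x ^ q ^ i) = poly f x ^ q ^ i"
proof -
  have "coeff f j ^ q ^ i = coeff f j" for j
    using coeff_f_Fix[of j i] by (simp add: Fix_def)
  hence "poly f x ^ q ^ i = (\<Sum>j\<le>degree f. coeff f j * (x ^ j) ^ q ^ i)"
    by (simp add: poly_altdef frob_sum power_mult_distrib)
  also have "\<dots> = poly f (x ^ q ^ i)"
    by (simp add: poly_altdef mult.commute flip: power_mult)
  finally show ?thesis by simp
qed

end

section \<open>Functions on the Artin--Schreier curve\<close>

context artin_schreier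
begin

definition curve :: "('k \<times> 'k) set" where
  "curve = {(x, z). z ^ q - z = poly f x}"

definition mon :: "nat \<times> nat \<Rightarrow> 'k \<times> 'k \<Rightarrow> 'k" where
  "mon v P = fst P ^ fst v * snd P ^ snd v"

text \<open>
  At the unique point at infinity of the curve, \<open>x\<close> has a pole of order \<open>q\<close> and \<open>z\<close> one of order
  \<open>degree f\<close>, so \<open>wt v\<close> is the pole order of the monomial \<open>mon v\<close>. As the weights of the monomials with
  \<open>z\<close>-exponent below \<open>q\<close> are distinct, \<open>low m w\<close> and \<open>lead m h w\<close> say that the pole order is less
  than, respectively equal to, \<open>w\<close>. All coefficients are taken from the finite field \<open>Fix m\<close>.
\<close>

definition wt :: "nat \<times> nat \<Rightarrow> nat" where
  "wt v = q * fst v + degree f * snd v"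

definition basis :: "nat \<Rightarrow> (nat \<times> nat) set" where
  "basis w = {v. snd v < q \<and> wt v < w}"

definition low :: "nat \<Rightarrow> nat \<Rightarrow> ('k \<times> 'k \<Rightarrow> 'k) set" where
  "low m w = {h. \<exists>c. (\<forall>v. c v \<in> Fix m) \<and> (\<forall>P\<in>curve. h P = (\<Sum>v\<in>basis w. c v * mon v P))}"

definition lead :: "nat \<Rightarrow> ('k \<times> 'k \<Rightarrow> 'k) \<Rightarrow> nat \<Rightarrow> bool" where
  "lead m h w \<longleftrightarrow> (\<exists>v \<kappa>. snd v < q \<and> wt v = w \<and> \<kappa> \<in> Fix m \<and> \<kappa> \<noteq> 0 \<and>
     (\<lambda>P. h P - \<kappa> * mon v P) \<in> low m w)"

section \<open>The filtration of functions on the curve by pole order\<close>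

lemma finite_basis [simp]: "finite (basis w)"
proof (rule finite_subset)
  show "basis w \<subseteq> {..<w} \<times> {..<q}"
  proof
    fix v assume "v \<in> basis w"
    hence v: "snd v < q" "q * fst v < w" by (auto simp: basis_def wt_def)
    have "1 * fst v \<le> q * fst v" by (rule mult_right_mono) (use q_ge_2 in auto)
    hence "fst v < w" using v by linarith
    with v show "v \<in> {..<w} \<times> {..<q}" by (auto simp: mem_Times_iff)
  qed
qed auto

lemma lowI:
  assumes "\<And>v. c v \<in> Fix m" "\<And>P. P \<in> curve \<Longrightarrow> h P = (\<Sum>v\<in>basis w. c v * mon v P)"
  shows "h \<in> low m w"
  using assms unfolding low_def by blast

lemma lowE:
  assumes "h \<in> low m w"
  obtains c where "\<And>v. c v \<in> Fix m" "\<And>P. P \<in> curve \<Longrightarrow> h P = (\<Sum>v\<in>basis w. c v * mon v P)"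
  using assms unfolding low_def by blast

lemma low_cong:
  assumes "h \<in> low m w" "\<And>P. P \<in> curve \<Longrightarrow> h' P = h P"
  shows "h' \<in> low m w"
  using assms by (simp add: low_def)

lemma low_mono:
  assumes "h \<in> low m w" "w \<le> w'"
  shows "h \<in> low m w'"
proof -
  obtain c where c: "\<And>v. c v \<in> Fix m" "\<And>P. P \<in> curve \<Longrightarrow> h P = (\<Sum>v\<in>basis w. c v * mon v P)"
    using lowE[OF assms(1)] by metis
  show ?thesis
  proof (rule lowI)
    fix v show "(if v \<in> basis w then c v else 0) \<in> Fix m" using c by simp
  next
    fix P assume P: "P \<in> curve"
    have "basis w \<subseteq> basis w'" using assms(2) by (auto simp: basis_def)
    hence "(\<Sum>v\<in>basis w'. (if v \<in> basis w then c v else 0) * mon v P) = (\<Sum>v\<in>basis w. c v * mon v P)"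
      by (intro sum.mono_neutral_cong_right) auto
    thus "h P = (\<Sum>v\<in>basis w'. (if v \<in> basis w then c v else 0) * mon v P)"
      using c(2)[OF P] by simp
  qed
qed

lemma low_zero: "(\<lambda>P. 0) \<in> low m w"
  by (rule lowI[of "\<lambda>_. 0"]) auto

lemma low_add:
  assumes "g \<in> low m w" "h \<in> low m w"
  shows "(\<lambda>P. g P + h P) \<in> low m w"
proof -
  obtain c where c: "\<And>v. c v \<in> Fix m" "\<And>P. P \<in> curve \<Longrightarrow> g P = (\<Sum>v\<in>basis w. c v * mon v P)"
    using lowE[OF assms(1)] by metis
  obtain c' where c': "\<And>v. c' v \<in> Fix m" "\<And>P. P \<in> curve \<Longrightarrow> h P = (\<Sum>v\<in>basis w. c' v * mon v P)"
    using lowE[OF assms(2)] by metis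
  show ?thesis
    by (rule lowI[of "\<lambda>v. c v + c' v"]) (auto simp: c c' sum.distrib algebra_simps)
qed

lemma low_smult:
  assumes "h \<in> low m w" "\<kappa> \<in> Fix m"
  shows "(\<lambda>P. \<kappa> * h P) \<in> low m w"
proof -
  obtain c where c: "\<And>v. c v \<in> Fix m" "\<And>P. P \<in> curve \<Longrightarrow> h P = (\<Sum>v\<in>basis w. c v * mon v P)"
    using lowE[OF assms(1)] by metis
  show ?thesis
    by (rule lowI[of "\<lambda>v. \<kappa> * c v"]) (auto simp: c assms sum_distrib_left mult.assoc)
qed

lemma low_sum:
  assumes "\<And>i. i \<in> A \<Longrightarrow> h i \<in> low m w"
  shows "(\<lambda>P. \<Sum>i\<in>A. h i P) \<in> low m w"
  using assms by (induction A rule: infinite_finite_induct) (auto simp: low_zero intro: low_add)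

lemma lead_cong:
  assumes "lead m h w" "\<And>P. P \<in> curve \<Longrightarrow> h' P = h P"
  shows "lead m h' w"
proof -
  obtain v \<kappa> where v: "snd v < q" "wt v = w" "\<kappa> \<in> Fix m" "\<kappa> \<noteq> 0" "(\<lambda>P. h P - \<kappa> * mon v P) \<in> low m w"
    using assms(1) unfolding lead_def by blast
  have "(\<lambda>P. h' P - \<kappa> * mon v P) \<in> low m w"
    by (rule low_cong[OF v(5)]) (simp add: assms(2))
  with v show ?thesis unfolding lead_def by blast
qed

lemma lead_add_low:
  assumes "lead m h w" "g \<in> low m w"
  shows "lead m (\<lambda>P. h P + g P) w"
proof -
  obtain v \<kappa> where v: "snd v < q" "wt v = w" "\<kappa> \<in> Fix m" "\<kappa> \<noteq> 0" "(\<lambda>P. h P - \<kappa> * mon v P) \<in> low m w"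
    using assms(1) unfolding lead_def by blast
  have "(\<lambda>P. h P + g P - \<kappa> * mon v P) \<in> low m w"
    by (rule low_cong[OF low_add[OF v(5) assms(2)]]) (simp add: algebra_simps)
  with v show ?thesis unfolding lead_def by blast
qed

lemma lead_smult:
  assumes "lead m h w" "\<mu> \<in> Fix m" "\<mu> \<noteq> 0"
  shows "lead m (\<lambda>P. \<mu> * h P) w"
proof -
  obtain v \<kappa> where v: "snd v < q" "wt v = w" "\<kappa> \<in> Fix m" "\<kappa> \<noteq> 0" "(\<lambda>P. h P - \<kappa> * mon v P) \<in> low m w"
    using assms(1) unfolding lead_def by blast
  have "(\<lambda>P. \<mu> * h P - (\<mu> * \<kappa>) * mon v P) \<in> low m w"
    by (rule low_cong[OF low_smult[OF v(5) assms(2)]]) (simp add: algebra_simps)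
  moreover have "\<mu> * \<kappa> \<in> Fix m" "\<mu> * \<kappa> \<noteq> 0" using v assms by auto
  ultimately show ?thesis using v unfolding lead_def by blast
qed

lemma mon_low:
  assumes "snd v < q" "wt v < w"
  shows "mon v \<in> low m w"
proof (rule lowI)
  fix v' show "(if v' = v then 1 else 0) \<in> Fix m" by simp
next
  fix P
  have "v \<in> basis w" using assms by (simp add: basis_def)
  have "(\<Sum>v'\<in>basis w. (if v' = v then 1 else 0) * mon v' P) = (\<Sum>v'\<in>basis w. if v' = v then mon v' P else 0)"
    by (intro sum.cong) auto
  also have "\<dots> = mon v P" using \<open>v \<in> basis w\<close> by simp
  finally show "mon v P = (\<Sum>v'\<in>basis w. (if v' = v then 1 else 0) * mon v' P)" by simp
qed

lemma lead_imp_low: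
  assumes "lead m h w"
  shows "h \<in> low m (Suc w)"
proof -
  obtain v \<kappa> where v: "snd v < q" "wt v = w" "\<kappa> \<in> Fix m" "\<kappa> \<noteq> 0" "(\<lambda>P. h P - \<kappa> * mon v P) \<in> low m w"
    using assms(1) unfolding lead_def by blast
  have "mon v \<in> low m (Suc w)" using v by (intro mon_low) auto
  from low_add[OF low_mono[OF v(5)] low_smult[OF this v(3)]] show ?thesis by simp
qed

lemma lead_imp_low_less: "lead m h w \<Longrightarrow> w < w' \<Longrightarrow> h \<in> low m w'"
  using lead_imp_low low_mono Suc_leI by blast

text \<open>Replacing \<open>z^q\<close> by \<open>z + f(x)\<close> trades it for a multiple of
  \<open>x^d\<close>, with \<open>d = degree f\<close>, which has the same weight, plus terms of
  smaller weight. Repeating this lowers the exponent of z until the monomial is reduced.\<close>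

lemma mon_lead: "lead m (mon v) (wt v)"
proof (induction "snd v" arbitrary: v rule: less_induct)
  case less
  show ?case
  proof (cases "snd v < q")
    case True
    have "(\<lambda>P. mon v P - 1 * mon v P) \<in> low m (wt v)" using low_zero by simp
    thus ?thesis using True unfolding lead_def by (intro exI[of _ v] exI[of _ 1]) auto
  next
    case False
    define i j where "i = fst v" and "j = snd v - q"
    have v: "v = (i, j + q)" using False by (auto simp: i_def j_def prod_eq_iff)
    define d where "d = degree f"
    have wt_v: "wt v = q * i + d * j + d * q" by (simp add: wt_def v d_def algebra_simps)
    have d_pos: "d > 0" using degree_f_pos by (simp add: d_def)
    have "lead m (mon (i + d, j)) (wt (i + d, j))"
      using less[of "(i + d, j)"] by (simp add: v)
    hence "lead m (mon (i + d, j)) (wt v)" by (simp only: wt_v) (simp add: wt_def d_def algebra_simps)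
    hence 1: "lead m (\<lambda>P. coeff f d * mon (i + d, j) P) (wt v)"
      using d_pos by (intro lead_smult coeff_f_Fix) (auto simp: d_def)
    have "mon (i, j + 1) \<in> low m (wt v)"
    proof (rule lead_imp_low_less)
      show "lead m (mon (i, j + 1)) (wt (i, j + 1))"
        using less[of "(i, j + 1)"] q_ge_2 by (simp add: v)
      have "d * 1 < d * q" by (rule mult_strict_left_mono) (use q_ge_2 d_pos in auto)
      thus "wt (i, j + 1) < wt v" unfolding wt_v by (simp add: wt_def d_def algebra_simps)
    qed
    moreover have "(\<lambda>P. \<Sum>k<d. coeff f k * mon (i + k, j) P) \<in> low m (wt v)"
    proof (intro low_sum low_smult coeff_f_Fix)
      fix k assume "k \<in> {..<d}"
      hence "q * k < q * d" using q_gt_0 by (intro mult_strict_left_mono) auto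
      hence *: "wt (i + k, j) < wt v" unfolding wt_v by (simp add: wt_def d_def algebra_simps)
      show "mon (i + k, j) \<in> low m (wt v)"
        by (rule lead_imp_low_less[OF _ *]) (rule less, simp add: v)
    qed
    ultimately have "(\<lambda>P. mon (i, j + 1) P + (\<Sum>k<d. coeff f k * mon (i + k, j) P)) \<in> low m (wt v)"
      by (rule low_add)
    from lead_add_low[OF 1 this] show ?thesis
    proof (rule lead_cong)
      fix P assume "P \<in> curve"
      hence P: "snd P ^ q = snd P + poly f (fst P)" by (auto simp: curve_def algebra_simps)
      have poly_f: "poly f (fst P) = coeff f d * fst P ^ d + (\<Sum>k<d. coeff f k * fst P ^ k)"
        by (simp add: poly_altdef d_def lessThan_Suc_atMost[symmetric])
      have "mon v P = fst P ^ i * snd P ^ j * (snd P + poly f (fst P))"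
        by (simp add: mon_def v power_add P mult.assoc)
      also have "\<dots> = coeff f d * mon (i + d, j) P +
          (mon (i, j + 1) P + (\<Sum>k<d. coeff f k * mon (i + k, j) P))"
        by (simp add: poly_f mon_def power_add algebra_simps sum_distrib_left)
      finally show "mon v P = coeff f d * mon (i + d, j) P +
          (mon (i, j + 1) P + (\<Sum>k<d. coeff f k * mon (i + k, j) P))" .
    qed
  qed
qed

lemma mon_mult: "mon v P * mon v' P = mon (v + v') P"
  by (simp add: mon_def power_add algebra_simps)

lemma wt_add: "wt (v + v') = wt v + wt v'"
  by (simp add: wt_def algebra_simps)

text \<open>Membership in \<open>low m (Suc w')\<close> means pole order at most \<open>w'\<close>,
  so a strict and a weak bound add up to a strict one.\<close>

lemma low_mult:
  assumes "g \<in> low m w" "h \<in> low m (Suc w')"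
  shows "(\<lambda>P. g P * h P) \<in> low m (w + w')"
proof -
  obtain c where c: "\<And>v. c v \<in> Fix m" "\<And>P. P \<in> curve \<Longrightarrow> g P = (\<Sum>v\<in>basis w. c v * mon v P)"
    using lowE[OF assms(1)] by metis
  obtain c' where c': "\<And>v. c' v \<in> Fix m" "\<And>P. P \<in> curve \<Longrightarrow> h P = (\<Sum>v\<in>basis (Suc w'). c' v * mon v P)"
    using lowE[OF assms(2)] by metis
  have "(\<lambda>P. \<Sum>v\<in>basis w. \<Sum>v'\<in>basis (Suc w'). (c v * c' v') * mon (v + v') P) \<in> low m (w + w')"
  proof (intro low_sum low_smult Fix_mult c c')
    fix v v' assume "v \<in> basis w" "v' \<in> basis (Suc w')"
    hence "wt (v + v') < w + w'" by (simp add: basis_def wt_add)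
    thus "mon (v + v') \<in> low m (w + w')" using mon_lead lead_imp_low_less by blast
  qed
  thus ?thesis
    by (rule low_cong) (simp add: c c' sum_product mon_mult[symmetric] mult_ac)
qed

text \<open>The product of two reduced leading monomials need not be reduced; this is why
  \<open>mon_lead\<close> covers arbitrary exponents.\<close>

lemma lead_mult:
  assumes "lead m g w" "lead m h w'"
  shows "lead m (\<lambda>P. g P * h P) (w + w')"
proof -
  obtain v \<kappa> where v: "snd v < q" "wt v = w" "\<kappa> \<in> Fix m" "\<kappa> \<noteq> 0" "(\<lambda>P. g P - \<kappa> * mon v P) \<in> low m w"
    using assms(1) unfolding lead_def by blast
  obtain v' \<kappa>' where v': "snd v' < q" "wt v' = w'" "\<kappa>' \<in> Fix m" "\<kappa>' \<noteq> 0" "(\<lambda>P. h P - \<kappa>' * mon v' P) \<in> low m w'"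
    using assms(2) unfolding lead_def by blast
  have "(\<lambda>P. (g P - \<kappa> * mon v P) * h P) \<in> low m (w + w')"
    by (rule low_mult[OF v(5) lead_imp_low[OF assms(2)]])
  moreover have "mon v \<in> low m (Suc w)" using lead_imp_low[OF mon_lead] v(2) by blast
  hence "(\<lambda>P. (h P - \<kappa>' * mon v' P) * mon v P) \<in> low m (w' + w)"
    by (rule low_mult[OF v'(5)])
  hence "(\<lambda>P. \<kappa> * ((h P - \<kappa>' * mon v' P) * mon v P)) \<in> low m (w + w')"
    using v(3) by (simp add: low_smult add.commute)
  ultimately have low: "(\<lambda>P. (g P - \<kappa> * mon v P) * h P + \<kappa> * ((h P - \<kappa>' * mon v' P) * mon v P)) \<in> low m (w + w')"
    by (rule low_add)
  have "lead m (\<lambda>P. (\<kappa> * \<kappa>') * mon (v + v') P) (w + w')"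
    using v v' mon_lead[of m "v + v'"] by (intro lead_smult Fix_mult) (auto simp: wt_add)
  from lead_add_low[OF this low] show ?thesis
    by (rule lead_cong) (auto simp: mon_mult[symmetric] algebra_simps)
qed

lemma lead_const: "\<kappa> \<in> Fix m \<Longrightarrow> \<kappa> \<noteq> 0 \<Longrightarrow> lead m (\<lambda>P. \<kappa>) 0"
  using lead_smult[OF mon_lead[of m "(0,0)"], of \<kappa>] by (simp add: mon_def wt_def)

lemma lead_power: "lead m h w \<Longrightarrow> lead m (\<lambda>P. h P ^ k) (k * w)"
proof (induction k)
  case 0
  show ?case using lead_const[of 1] by simp
next
  case (Suc k)
  from lead_mult[OF Suc.prems Suc.IH[OF Suc.prems]] show ?case by simp
qed

lemma low_power: "h \<in> low m w \<Longrightarrow> (\<lambda>P. h P ^ k) \<in> low m (Suc (k * w))"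
proof (induction k)
  case 0
  show ?case using lead_imp_low[OF lead_const[of 1]] by simp
next
  case (Suc k)
  from low_mult[OF Suc.prems Suc.IH[OF Suc.prems]] have "(\<lambda>P. h P ^ Suc k) \<in> low m (w + k * w)" by simp
  thus ?case by (rule low_mono) simp
qed

text \<open>Translating z by a constant only adds terms of lower order. Such translated monomials
  arise as the q^m-th powers of monomials at the points to be counted.\<close>

lemma lead_shifted_mon:
  assumes "\<gamma> \<in> Fix m"
  shows "lead m (\<lambda>P. mon v (fst P, snd P + \<gamma>)) (wt v)"
proof -
  have fst: "lead m (\<lambda>P. fst P) q"
    using mon_lead[of m "(1,0)"] by (simp add: mon_def[abs_def] wt_def)
  have snd: "lead m (\<lambda>P. snd P) (degree f)"
    using mon_lead[of m "(0,1)"] by (simp add: mon_def[abs_def] wt_def)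
  have "(\<lambda>P. \<gamma>) \<in> low m (degree f)"
  proof (cases "\<gamma> = 0")
    case True thus ?thesis by (simp add: low_zero)
  next
    case False
    from lead_imp_low_less[OF lead_const[OF assms this] degree_f_pos] show ?thesis .
  qed
  from lead_add_low[OF snd this] have snd': "lead m (\<lambda>P. snd P + \<gamma>) (degree f)" .
  show ?thesis
    using lead_mult[OF lead_power[OF fst, of "fst v"] lead_power[OF snd', of "snd v"]]
    by (simp add: mon_def wt_def mult.commute)
qed

text \<open>Modulo q only the contribution of z remains, and \<open>degree f\<close> is a unit
  there. So the weight determines first the exponent of z and then that of x.\<close>

lemma inj_wt: "inj_on wt {v. snd v < q}"
proof (rule inj_onI)
  fix v v' :: "nat \<times> nat"
  assume v: "v \<in> {v. snd v < q}" "v' \<in> {v. snd v < q}" and eq: "wt v = wt v'"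
  have "wt v mod q = degree f * snd v mod q" "wt v' mod q = degree f * snd v' mod q"
    by (simp_all add: wt_def)
  hence "[degree f * snd v = degree f * snd v'] (mod q)"
    using eq by (simp only: unique_euclidean_semiring_class.cong_def)
  hence "[snd v = snd v'] (mod q)"
    using coprime_degree by (simp add: cong_mult_lcancel_nat)
  hence "snd v = snd v'" using v by (simp add: unique_euclidean_semiring_class.cong_def)
  moreover from this have "fst v = fst v'" using eq by (simp add: wt_def)
  ultimately show "v = v'" by (simp add: prod_eq_iff)
qed

lemma card_basis_le: "card (basis w) \<le> w"
proof -
  have "card (basis w) = card (wt ` basis w)"
    by (intro card_image[symmetric] inj_on_subset[OF inj_wt]) (auto simp: basis_def)
  also have "\<dots> \<le> card {..<w}"
    by (intro card_mono) (auto simp: basis_def)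
  finally show ?thesis by simp
qed

text \<open>Each integer t from \<open>degree f * q\<close> on is a weight: choose the exponent j <
  q of z with degree f * j congruent to t modulo q; the nonnegative remainder is a multiple of q.
  Together with \<open>card_basis_le\<close> this crude count takes the place of the Riemann-Roch
  theorem.\<close>

lemma card_basis_ge: "w - degree f * q \<le> card (basis w)"
proof -
  have "{degree f * q..<w} \<subseteq> wt ` basis w"
  proof
    fix t assume t: "t \<in> {degree f * q..<w}"
    obtain x where x: "[degree f * x = 1] (mod q)"
      using cong_solve_coprime_nat[OF coprime_degree] by auto
    define j where "j = x * t mod q"
    have j: "j < q" by (simp add: j_def)
    have "[degree f * j = (degree f * x) * t] (mod q)"
      by (simp only: j_def unique_euclidean_semiring_class.cong_def mod_mult_right_eq mult.assoc)
    also have "[(degree f * x) * t = 1 * t] (mod q)" by (intro cong_mult x cong_refl)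
    finally have c: "[t = degree f * j] (mod q)" by (simp add: cong_sym_eq)
    have "degree f * j \<le> degree f * q" using j by (intro mult_left_mono) auto
    moreover have "degree f * q \<le> t" using t by simp
    ultimately have le: "degree f * j \<le> t" by (rule order.trans)
    hence "q dvd t - degree f * j" using c by (simp add: cong_altdef_nat)
    then obtain i where "t - degree f * j = q * i" by auto
    hence "t = wt (i, j)" using le by (simp add: wt_def)
    moreover have "(i, j) \<in> basis w" using calculation t j by (simp add: basis_def)
    ultimately show "t \<in> wt ` basis w" by blast
  qed
  hence "card {degree f * q..<w} \<le> card (wt ` basis w)" by (intro card_mono) auto
  also have "\<dots> \<le> card (basis w)" by (rule card_image_le) simp
  finally show ?thesis by simp
qed

text \<open>Distinct pole orders cannot cancel, so the summand with the largest one governs the sum.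
  The index set may contain further summands that vanish on the curve.\<close>

lemma lead_sum:
  assumes "finite A" "A0 \<subseteq> A" "A0 \<noteq> {}"
    and lead: "\<And>v. v \<in> A0 \<Longrightarrow> lead m (h v) (k v)"
    and zero: "\<And>v P. v \<in> A - A0 \<Longrightarrow> P \<in> curve \<Longrightarrow> h v P = 0"
    and inj: "inj_on k A0"
  shows "\<exists>v\<in>A0. lead m (\<lambda>P. \<Sum>v\<in>A. h v P) (k v)"
proof -
  have fin: "finite A0" using assms finite_subset by blast
  have "Max (k ` A0) \<in> k ` A0" using fin assms by (intro Max_in) auto
  then obtain v0 where v0: "v0 \<in> A0" "k v0 = Max (k ` A0)" by auto
  have "(\<lambda>P. \<Sum>v\<in>A - {v0}. h v P) \<in> low m (k v0)"
  proof (rule low_sum)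
    fix v assume v: "v \<in> A - {v0}"
    show "h v \<in> low m (k v0)"
    proof (cases "v \<in> A0")
      case True
      have "k v \<le> k v0" unfolding v0(2) using fin True by simp
      moreover have "k v \<noteq> k v0" using True v0(1) v inj by (auto dest: inj_onD)
      ultimately show ?thesis using lead[OF True] lead_imp_low_less by simp
    next
      case False
      thus ?thesis using v by (intro low_cong[OF low_zero]) (auto intro: zero)
    qed
  qed
  from lead_add_low[OF lead[OF v0(1)] this]
  have "lead m (\<lambda>P. \<Sum>v\<in>A. h v P) (k v0)"
    using assms(1,2) v0(1) by (subst sum.remove[of A v0]) auto
  thus ?thesis using v0 by blast
qed

lemma lead_combination:
  assumes "\<And>v. c v \<in> Fix m" "v \<in> basis l" "c v \<noteq> 0"
  shows "\<exists>w<l. lead m (\<lambda>P. \<Sum>v\<in>basis l. c v * mon v P) w"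
proof -
  have "v \<in> {v \<in> basis l. c v \<noteq> 0}" using assms by simp
  hence "{v \<in> basis l. c v \<noteq> 0} \<noteq> {}" by blast
  moreover have "inj_on wt {v \<in> basis l. c v \<noteq> 0}"
    by (rule inj_on_subset[OF inj_wt]) (auto simp: basis_def)
  ultimately have "\<exists>v\<in>{v \<in> basis l. c v \<noteq> 0}. lead m (\<lambda>P. \<Sum>v\<in>basis l. c v * mon v P) (wt v)"
    using assms(1) by (intro lead_sum lead_smult mon_lead) auto
  thus ?thesis by (auto simp: basis_def)
qed

section \<open>Fibers over the x-line and the number of zeros of a function\<close>

lemma exists_fiber: "\<exists>z. (x, z) \<in> curve"
proof -
  define g where "g i = (if i = 0 then - poly f x else if i = 1 then -1 else if i = q then 1 else 0)" for i
  have "\<exists>z. (\<Sum>k\<le>q. g k * z ^ k) = 0"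
    using q_ge_2 by (intro alg_closed) (auto simp: g_def)
  moreover have "(\<Sum>k\<le>q. g k * z ^ k) = z ^ q - z - poly f x" for z
  proof -
    have "(\<Sum>k\<le>q. g k * z ^ k) = (\<Sum>k\<in>{0,1,q}. g k * z ^ k)"
      using q_ge_2 by (intro sum.mono_neutral_right) (auto simp: g_def)
    also have "\<dots> = z ^ q - z - poly f x" using q_ge_2 by (simp add: g_def)
    finally show ?thesis .
  qed
  ultimately show ?thesis by (auto simp: curve_def algebra_simps)
qed

text \<open>Adding an element of F_q to z does not change \<open>z^q - z\<close>, so one point over
  x yields q of them.\<close>

lemma card_fiber: "\<exists>Z. finite Z \<and> card Z = q \<and> (\<forall>z\<in>Z. (x, z) \<in> curve)"
proof -
  obtain z where z: "(x, z) \<in> curve" using exists_fiber by blast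
  have "card ((+) z ` Fix 1) = q" using card_Fix[of 1] by (simp add: card_image)
  moreover have "(x, z + y) \<in> curve" if "y \<in> Fix 1" for y
    using z that unfolding Fix_1_iff by (simp add: curve_def frob_add_q)
  ultimately show ?thesis
    using finite_Fix[of 1] by (intro exI[of _ "(+) z ` Fix 1"]) auto
qed

text \<open>This stands in for the fact that a function has no more zeros than poles. Only whole
  fibers occur: a polynomial in z of degree below q that vanishes at the q points over x is zero, so
  x is a root of every coefficient \<open>h j\<close>. The coefficient that contains the leading
  monomial is nonzero of degree at most \<open>w div q\<close>.\<close>

lemma card_zeros_le:
  assumes lead: "lead m H w" and zero: "\<And>x z. x \<in> pts \<Longrightarrow> (x, z) \<in> curve \<Longrightarrow> H (x, z) = 0"
  shows "q * card pts \<le> w"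
proof -
  obtain v0 \<kappa> where v0: "snd v0 < q" "wt v0 = w" "\<kappa> \<noteq> 0" "(\<lambda>P. H P - \<kappa> * mon v0 P) \<in> low m w"
    using lead unfolding lead_def by blast
  obtain c where c: "\<And>P. P \<in> curve \<Longrightarrow> H P - \<kappa> * mon v0 P = (\<Sum>v\<in>basis w. c v * mon v P)"
    using lowE[OF v0(4)] by metis
  define B where "B = insert v0 (basis w)"
  have v0_notin: "v0 \<notin> basis w" using v0 by (simp add: basis_def)
  define e where "e v = (if v = v0 then \<kappa> else c v)" for v
  have fin: "finite B" by (simp add: B_def)
  have B: "snd v < q" "q * fst v \<le> w" if "v \<in> B" for v
    using that v0 by (auto simp: B_def basis_def wt_def)
  have H: "H P = (\<Sum>v\<in>B. e v * mon v P)" if "P \<in> curve" for P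
  proof -
    have "(\<Sum>v\<in>basis w. e v * mon v P) = (\<Sum>v\<in>basis w. c v * mon v P)"
      using v0_notin by (intro sum.cong) (auto simp: e_def)
    thus ?thesis using c[OF that] v0_notin by (simp add: B_def e_def algebra_simps)
  qed
  define h where "h j = (\<Sum>v\<in>{v\<in>B. snd v = j}. monom (e v) (fst v))" for j
  define G where "G x = (\<Sum>j<q. monom (poly (h j) x) j)" for x
  have G: "poly (G x) z = H (x, z)" if "(x, z) \<in> curve" for x z
  proof -
    have "poly (G x) z = (\<Sum>j<q. \<Sum>v\<in>{v\<in>B. snd v = j}. e v * mon v (x, z))"
      by (simp add: G_def poly_sum poly_monom h_def sum_distrib_right mon_def mult.assoc)
    also have "\<dots> = (\<Sum>v\<in>B. e v * mon v (x, z))"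
      by (rule sum.group) (use fin B in auto)
    finally show ?thesis using H[OF that] by simp
  qed
  have "coeff (h (snd v0)) (fst v0) = (\<Sum>v\<in>{v\<in>B. snd v = snd v0}. if v = v0 then \<kappa> else 0)"
    unfolding h_def coeff_sum by (intro sum.cong) (auto simp: e_def prod_eq_iff)
  also have "\<dots> = \<kappa>" using fin by (simp add: B_def)
  finally have h_nz: "h (snd v0) \<noteq> 0" using v0(3) by auto
  have deg: "degree (h (snd v0)) \<le> w div q"
    unfolding h_def
  proof (rule degree_sum_le)
    fix v assume "v \<in> {v \<in> B. snd v = snd v0}"
    hence "fst v \<le> w div q" using B(2)[of v] by (simp add: less_eq_div_iff_mult_less_eq mult.commute)
    thus "degree (monom (e v) (fst v)) \<le> w div q" using degree_monom_le le_trans by blast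
  qed (use fin in auto)
  have "pts \<subseteq> {x. poly (h (snd v0)) x = 0}"
  proof
    fix x assume x: "x \<in> pts"
    obtain Z where Z: "finite Z" "card Z = q" "\<And>z. z \<in> Z \<Longrightarrow> (x, z) \<in> curve"
      using card_fiber[of x] by auto
    have "G x = 0"
    proof (rule ccontr)
      assume nz: "G x \<noteq> 0"
      have "Z \<subseteq> {z. poly (G x) z = 0}" using G Z zero x by auto
      hence "q \<le> card {z. poly (G x) z = 0}"
        using Z(2) card_mono[OF poly_roots_finite[OF nz]] by blast
      also have "\<dots> \<le> degree (G x)" by (rule card_poly_roots_bound[OF nz])
      also have "degree (G x) \<le> q - 1" unfolding G_def
        by (intro degree_sum_le) (auto intro: order.trans[OF degree_monom_le])
      finally show False using q_gt_0 by linarith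
    qed
    hence "coeff (G x) (snd v0) = 0" by simp
    moreover have "coeff (G x) (snd v0) = poly (h (snd v0)) x"
      using v0(1) by (simp add: G_def coeff_sum)
    ultimately show "x \<in> {x. poly (h (snd v0)) x = 0}" by simp
  qed
  hence "card pts \<le> card {x. poly (h (snd v0)) x = 0}"
    by (intro card_mono poly_roots_finite h_nz)
  also have "\<dots> \<le> degree (h (snd v0))" by (rule card_poly_roots_bound[OF h_nz])
  also have "\<dots> \<le> w div q" by (rule deg)
  finally show ?thesis by (simp add: less_eq_div_iff_mult_less_eq mult.commute)
qed

end

section \<open>The Stepanov--Bombieri bound\<close>

context artin_schreier
begin

lemma frob_power: "(x ^ k) ^ (q ^ r) = (x ^ (q ^ r)) ^ k" for x :: 'k
  by (simp add: mult.commute flip: power_mult)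

text \<open>
  The map sending the coefficients \<open>c\<close> to the function below is additive, so a nonzero element of
  its kernel exists by counting as soon as the source is larger than the target.
\<close>

lemma exists_kernel:
  assumes card: "card (basis (q ^ r * l + M)) < card (basis l) * card (basis M)"
    and m: "m > 0" and \<gamma>: "\<gamma> \<in> Fix m"
  defines "U \<equiv> \<lambda>c v P. \<Sum>s\<in>basis l. c (s, v) * mon s P"
  shows "\<exists>c. (\<forall>x. c x \<in> Fix m) \<and> (\<exists>s\<in>basis l. \<exists>v\<in>basis M. c (s, v) \<noteq> 0) \<and>
           (\<forall>P\<in>curve. (\<Sum>v\<in>basis M. U c v P ^ (q ^ r) * mon v (fst P, snd P + \<gamma>)) = 0)"
proof -
  define W where "W = q ^ r * l + M"
  define T where "T c P = (\<Sum>v\<in>basis M. U c v P ^ (q ^ r) * mon v (fst P, snd P + \<gamma>))" for c P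
  define A where "A = (basis l \<times> basis M) \<rightarrow>\<^sub>E Fix m"
  define B where "B = basis W \<rightarrow>\<^sub>E Fix m"
  have fin: "finite A" "finite B"
    unfolding A_def B_def using finite_Fix[OF m] by (auto intro!: finite_PiE)
  have T_low: "T c \<in> low m W" if c: "\<And>x. x \<in> basis l \<times> basis M \<Longrightarrow> c x \<in> Fix m" for c
    unfolding T_def
  proof (rule low_sum)
    fix v assume v: "v \<in> basis M"
    have "U c v \<in> low m l" unfolding U_def
    proof (rule low_sum)
      fix s assume s: "s \<in> basis l"
      show "(\<lambda>P. c (s, v) * mon s P) \<in> low m l"
        using s v c by (intro low_smult mon_low) (auto simp: basis_def)
    qed
    from low_mult[OF low_power[OF this] lead_imp_low[OF lead_shifted_mon[OF \<gamma>]], of "q ^ r" v]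
    show "(\<lambda>P. U c v P ^ q ^ r * mon v (fst P, snd P + \<gamma>)) \<in> low m W"
      by (rule low_mono) (use v in \<open>simp add: W_def basis_def\<close>)
  qed
  have "\<exists>e\<in>B. \<forall>P\<in>curve. T c P = (\<Sum>v\<in>basis W. e v * mon v P)" if "c \<in> A" for c
  proof -
    have "T c \<in> low m W" using that by (intro T_low) (auto simp: A_def)
    then obtain e where e: "\<And>v. e v \<in> Fix m" "\<And>P. P \<in> curve \<Longrightarrow> T c P = (\<Sum>v\<in>basis W. e v * mon v P)"
      using lowE[OF \<open>T c \<in> low m W\<close>] by metis
    show ?thesis
      by (rule bexI[of _ "restrict e (basis W)"]) (auto simp: B_def e)
  qed
  then obtain E where E: "\<And>c. c \<in> A \<Longrightarrow> E c \<in> B"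
    "\<And>c P. c \<in> A \<Longrightarrow> P \<in> curve \<Longrightarrow> T c P = (\<Sum>v\<in>basis W. E c v * mon v P)"
    by metis
  have "card B < card A"
  proof -
    have "card A = (q ^ m) ^ (card (basis l) * card (basis M))"
      by (simp add: A_def card_PiE card_Fix[OF m] card_cartesian_product)
    moreover have "card B = (q ^ m) ^ card (basis W)"
      by (simp add: B_def card_PiE card_Fix[OF m])
    moreover have "q ^ m > 1" using q_ge_2 m by (intro one_less_power) auto
    ultimately show ?thesis using card by (simp add: W_def)
  qed
  hence "card (E ` A) < card A"
    using E(1) card_mono[OF fin(2), of "E ` A"] by fastforce
  hence "\<not> inj_on E A" by (rule pigeonhole)
  then obtain c c' where cc': "c \<in> A" "c' \<in> A" "c \<noteq> c'" "E c = E c'"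
    by (auto simp: inj_on_def)
  then obtain x0 where x0: "c x0 \<noteq> c' x0" "x0 \<in> basis l \<times> basis M"
    unfolding A_def using PiE_ext by metis
  \<comment> \<open>Elements of \<open>A\<close> are \<open>undefined\<close> off the index set;
    continuing the difference by 0 puts all its values into \<open>Fix m\<close>.\<close>
  define b where "b x = (if x \<in> basis l \<times> basis M then c x - c' x else 0)" for x
  have b_Fix: "b x \<in> Fix m" for x
    using cc' by (auto simp: b_def A_def)
  have U_b: "U b v P = U c v P - U c' v P" if "v \<in> basis M" for v P
    using that by (auto simp: U_def b_def left_diff_distrib sum_subtractf)
  have "T b P = 0" if "P \<in> curve" for P
  proof -
    have "T b P = T c P - T c' P"
      by (simp add: T_def U_b frob_diff left_diff_distrib sum_subtractf)
    also have "\<dots> = 0" using E(2) that cc' by simp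
    finally show ?thesis .
  qed
  moreover have "b x0 \<noteq> 0" using x0 by (simp add: b_def)
  ultimately show ?thesis
    using b_Fix x0(2) unfolding T_def by (intro exI[of _ b]) auto
qed

lemma card_trace_fiber_le:
  fixes r :: nat and \<gamma> :: 'k
  defines "R \<equiv> q ^ r" and "e \<equiv> degree f * q"
  assumes r: "r > 0" and large: "R > e * e + 4 * e + 2" and \<gamma>: "\<gamma> \<in> Fix 1"
  shows "q * card {x \<in> Fix (2 * r). trace (2 * r) (poly f x) = \<gamma>} \<le> R * R + (2 * e + 2) * R"
proof -
  define m where "m = 2 * r"
  \<comment> \<open>With this choice (R - e)(M - e) = R^2 + 2R - e^2 - 2e exceeds R^2 + M exactly if
    R > e^2 + 4e + 2, which is the hypothesis \<open>large\<close>. The final bound is R *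
    M.\<close>
  define M where "M = R + 2 * e + 2"
  have m: "m > 0" using r by (simp add: m_def)
  have \<gamma>': "\<gamma> \<in> Fix m" using \<gamma> Fix_1_subset by blast
  have "card (basis (q ^ r * R + M)) < card (basis R) * card (basis M)"
  proof -
    have "e \<le> e * e" by simp
    hence "e \<le> R" using large by linarith
    then obtain R' where R': "R = R' + e" by (metis add.commute le_iff_add)
    have "card (basis (q ^ r * R + M)) \<le> R * R + M" unfolding R_def by (rule card_basis_le)
    also have "R * R + M < R' * (R' + 2 * e + 2)"
      using large by (simp add: M_def R' algebra_simps)
    also have "\<dots> = (R - e) * (M - e)" by (simp add: M_def R')
    also have "\<dots> \<le> card (basis R) * card (basis M)"
      unfolding e_def by (intro mult_mono card_basis_ge) auto
    finally show ?thesis .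
  qed
  from exists_kernel[OF this m \<gamma>'] obtain c where
    c: "\<And>x. c x \<in> Fix m" and nz: "\<exists>s\<in>basis R. \<exists>v\<in>basis M. c (s, v) \<noteq> 0"
    and ker: "\<And>P. P \<in> curve \<Longrightarrow>
      (\<Sum>v\<in>basis M. (\<Sum>s\<in>basis R. c (s, v) * mon s P) ^ R * mon v (fst P, snd P + \<gamma>)) = 0"
    unfolding R_def by blast
  define U where "U v P = (\<Sum>s\<in>basis R. c (s, v) * mon s P)" for v P
  define H where "H P = (\<Sum>v\<in>basis M. U v P * mon v P ^ R)" for P
  define A0 where "A0 = {v\<in>basis M. \<exists>s\<in>basis R. c (s, v) \<noteq> 0}"
  have "\<exists>w<R. lead m (U v) w" if "v \<in> A0" for v
    using that lead_combination[of "\<lambda>s. c (s, v)" m _ R] c unfolding A0_def U_def by blast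
  then obtain k where k: "\<And>v. v \<in> A0 \<Longrightarrow> k v < R" "\<And>v. v \<in> A0 \<Longrightarrow> lead m (U v) (k v)"
    by metis
  \<comment> \<open>The pole order \<open>k v\<close> of \<open>U v\<close> is below R, so
    \<open>wt v\<close> is the quotient of \<open>k v + R * wt v\<close> by R. The orders of the
    summands of \<open>H\<close> are therefore distinct, and \<open>H\<close> does not vanish
    identically.\<close>
  have "\<exists>v\<in>A0. lead m H (k v + R * wt v)"
    unfolding H_def
  proof (rule lead_sum)
    show "A0 \<noteq> {}" using nz by (auto simp: A0_def)
    show "lead m (\<lambda>P. U v P * mon v P ^ R) (k v + R * wt v)" if "v \<in> A0" for v
      by (intro lead_mult lead_power mon_lead k that)
    show "U v P * mon v P ^ R = 0" if "v \<in> basis M - A0" for v P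
      using that by (auto simp: U_def A0_def intro!: sum.neutral)
    show "inj_on (\<lambda>v. k v + R * wt v) A0"
    proof (rule inj_onI)
      fix v v' assume v: "v \<in> A0" "v' \<in> A0" and eq: "k v + R * wt v = k v' + R * wt v'"
      have "(k v + R * wt v) div R = wt v" "(k v' + R * wt v') div R = wt v'"
        using k(1)[OF v(1)] k(1)[OF v(2)] by auto
      hence "wt v = wt v'" using eq by simp
      thus "v = v'" using v inj_wt by (auto simp: A0_def basis_def dest!: inj_onD)
    qed
  qed (auto simp: A0_def)
  then obtain v where v: "v \<in> A0" and lead: "lead m H (k v + R * wt v)" by blast
  have "k v + R * wt v < R * Suc (wt v)" using k(1)[OF v] by simp
  also have "\<dots> \<le> R * M" using v by (intro mult_left_mono) (auto simp: A0_def basis_def)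
  finally have wt_le: "k v + R * wt v \<le> R * M" by simp
  have "q * card {x \<in> Fix m. trace m (poly f x) = \<gamma>} \<le> k v + R * wt v"
  proof (rule card_zeros_le[OF lead])
    fix x z assume x: "x \<in> {x \<in> Fix m. trace m (poly f x) = \<gamma>}" and xz: "(x, z) \<in> curve"
    \<comment> \<open>Iterating the equation of the curve, every further q-th power adds one
      conjugate of f(x).\<close>
    have z: "z ^ (q ^ i) = z + trace i (poly f x)" for i
    proof (induction i)
      case (Suc i)
      have zq: "z ^ q = z + poly f x" using xz by (simp add: curve_def algebra_simps)
      have "z ^ (q ^ Suc i) = (z ^ q) ^ (q ^ i)" by (simp flip: power_mult)
      also have "\<dots> = z ^ (q ^ i) + poly f x ^ (q ^ i)" by (simp add: zq frob_add)
      also have "\<dots> = z + trace (Suc i) (poly f x)" by (simp add: Suc trace_def)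
      finally show ?case .
    qed (simp add: trace_def)
    have RR: "q ^ m = R * R" by (simp add: m_def R_def power_add mult_2)
    have "mon v (x, z + \<gamma>) = (mon v (x, z) ^ R) ^ R" for v
    proof -
      have "x ^ (q ^ m) = x" using x by (simp add: Fix_def)
      moreover have "z ^ (q ^ m) = z + \<gamma>" using z[of m] x by simp
      moreover have "mon v (x, z) ^ (q ^ m) = mon v (x ^ (q ^ m), z ^ (q ^ m))"
        by (simp add: mon_def power_mult_distrib frob_power)
      ultimately show ?thesis by (simp add: RR power_mult)
    qed
    hence "(\<Sum>v\<in>basis M. U v (x, z) ^ R * (mon v (x, z) ^ R) ^ R) = 0"
      using ker[OF xz] by (simp only: U_def fst_conv snd_conv)
    hence "H (x, z) ^ R = 0"
      by (simp only: H_def R_def frob_sum power_mult_distrib)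
    thus "H (x, z) = 0" by simp
  qed
  also have "\<dots> \<le> R * M" by (rule wt_le)
  finally show ?thesis by (simp add: M_def m_def algebra_simps)
qed

end

section \<open>Monic polynomials over the finite field\<close>

lemma proots_prod_linear: "proots (\<Prod>x\<in>#A. [:-x, 1:]) = (A :: 'a::idom multiset)"
proof (induction A)
  case (add x A)
  have "(\<Prod>x\<in>#A. [:-x, 1:]) \<noteq> 0"
    by (auto simp: prod_mset_zero_iff)
  thus ?case using add by (simp add: proots_mult del: mult_pCons_left)
qed simp

lemma poly_eq_prod_proots:
  fixes p :: "'k::alg_closed_field poly"
  assumes "p \<noteq> 0"
  shows "p = smult (lead_coeff p) (\<Prod>x\<in>#proots p. [:-x, 1:])" and "size (proots p) = degree p"
proof -
  obtain A where A: "size A = degree p" "p = smult (lead_coeff p) (\<Prod>x\<in>#A. [:-x, 1:])"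
    using alg_closed_imp_factorization[OF assms] by blast
  have "proots p = A"
    using assms by (subst A(2)) (simp add: proots_prod_linear)
  thus "p = smult (lead_coeff p) (\<Prod>x\<in>#proots p. [:-x, 1:])" "size (proots p) = degree p"
    using A by simp_all
qed

lemma sum_order_eq_degree:
  fixes p :: "'k::alg_closed_field poly"
  assumes "p \<noteq> 0"
  shows "(\<Sum>x | poly p x = 0. order x p) = degree p"
  using poly_eq_prod_proots(2)[OF assms] assms by (simp add: size_multiset_overloaded_eq)

text \<open>Over an algebraically closed field a polynomial is, up to a constant, its multiset of
  roots.\<close>

lemma dvd_iff_order_le:
  fixes p g :: "'k::alg_closed_field poly"
  assumes "p \<noteq> 0" "g \<noteq> 0"
  shows "p dvd g \<longleftrightarrow> (\<forall>x. order x p \<le> order x g)"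
proof
  assume "p dvd g"
  then obtain h where "g = p * h" by auto
  thus "\<forall>x. order x p \<le> order x g" using assms by (auto simp: order_mult)
next
  assume "\<forall>x. order x p \<le> order x g"
  hence "proots p \<subseteq># proots g" using assms by (simp add: subseteq_mset_def)
  hence "(\<Prod>x\<in>#proots p. [:-x, 1:]) dvd (\<Prod>x\<in>#proots g. [:-x, 1:])"
    by (intro prod_mset_subset_imp_dvd image_mset_subseteq_mono)
  thus "p dvd g"
    by (subst poly_eq_prod_proots(1)[OF assms(1)], subst poly_eq_prod_proots(1)[OF assms(2)])
       (use assms in \<open>auto simp: smult_dvd_iff dvd_smult\<close>)
qed

context artin_schreier
begin

definition frob_poly :: "'k poly \<Rightarrow> 'k poly" where
  "frob_poly = map_poly (\<lambda>x. x ^ q)"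

lemma coeff_frob_poly [simp]: "coeff (frob_poly g) i = coeff g i ^ q"
  by (simp add: frob_poly_def coeff_map_poly)

lemma frob_poly_mult: "frob_poly (g * h) = frob_poly g * frob_poly h"
  by (rule poly_eqI) (simp add: coeff_mult frob_sum_q power_mult_distrib)

lemma frob_poly_1 [simp]: "frob_poly 1 = 1"
  by (rule poly_eqI) (simp add: coeff_1)

lemma frob_poly_prod: "frob_poly (\<Prod>i\<in>A. g i) = (\<Prod>i\<in>A. frob_poly (g i))"
  by (induction A rule: infinite_finite_induct) (auto simp: frob_poly_mult)

lemma frob_poly_power: "frob_poly (g ^ j) = frob_poly g ^ j"
  by (induction j) (auto simp: frob_poly_mult)

lemma frob_minus_q: "(- x :: 'k) ^ q = - (x ^ q)"
  using frob_minus[of x 1] by simp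

lemma frob_poly_linear: "frob_poly [:-x, 1:] = [:-(x ^ q), 1:]"
  by (rule poly_eqI) (auto simp: coeff_pCons frob_minus_q split: nat.splits)

text \<open>These are the monic polynomials over F_q. Expressing rationality as invariance under
  \<open>frob_poly\<close> keeps them in the type where they split, so that roots and divisibility
  can be used directly.\<close>

definition monics :: "nat \<Rightarrow> 'k poly set" where
  "monics k = {g. degree g = k \<and> lead_coeff g = 1 \<and> frob_poly g = g}"

lemma monics_nonzero: "g \<in> monics k \<Longrightarrow> g \<noteq> 0"
  by (auto simp: monics_def)

lemma frob_poly_iff: "frob_poly g = g \<longleftrightarrow> (\<forall>i. coeff g i \<in> Fix 1)"
  unfolding Fix_1_iff by (simp add: poly_eq_iff)

lemma monics_coeff: "g \<in> monics k \<Longrightarrow> coeff g i \<in> Fix 1"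
  using frob_poly_iff by (auto simp: monics_def)

lemma finite_monics: "finite (monics k)"
proof (rule finite_subset)
  show "monics k \<subseteq> Poly ` {xs. set xs \<subseteq> Fix 1 \<and> length xs = Suc k}"
  proof
    fix g assume g: "g \<in> monics k"
    have "set (coeffs g) \<subseteq> Fix 1"
    proof
      fix x assume "x \<in> set (coeffs g)"
      then obtain i where "x = coeff g i"
        by (metis coeffs_nth in_set_conv_nth length_coeffs_degree less_Suc_eq_le length_0_conv
            list.size(3) coeffs_eq_Nil not_less0)
      thus "x \<in> Fix 1" using monics_coeff[OF g] by simp
    qed
    moreover have "length (coeffs g) = Suc k"
      using g monics_nonzero[OF g] by (simp add: monics_def length_coeffs_degree)
    ultimately have "coeffs g \<in> {xs. set xs \<subseteq> Fix 1 \<and> length xs = Suc k}" by simp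
    thus "g \<in> Poly ` {xs. set xs \<subseteq> Fix 1 \<and> length xs = Suc k}"
      by (intro image_eqI[of _ _ "coeffs g"]) simp_all
  qed
  show "finite (Poly ` {xs. set xs \<subseteq> Fix 1 \<and> length xs = Suc k})"
    by (intro finite_imageI finite_lists_length_eq finite_Fix) simp
qed

lemma monics_0: "monics 0 = {1}"
proof -
  have "g = 1" if "degree g = 0" "lead_coeff g = 1" for g :: "'k poly"
  proof -
    obtain c where "g = [:c:]" using \<open>degree g = 0\<close> by (rule degree_eq_zeroE)
    thus ?thesis using that by (simp add: one_pCons)
  qed
  thus ?thesis by (auto simp: monics_def)
qed

lemma monics_mult: "g \<in> monics k \<Longrightarrow> h \<in> monics l \<Longrightarrow> g * h \<in> monics (k + l)"
  using monics_nonzero[of g k] monics_nonzero[of h l]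
  by (auto simp: monics_def degree_mult_eq frob_poly_mult lead_coeff_mult)

text \<open>\<open>frob_poly\<close> is multiplicative and fixes both \<open>g\<close> and
  \<open>p\<close>; cancelling \<open>p\<close> shows that it fixes the cofactor.\<close>

lemma monics_divide:
  assumes "g \<in> monics k" "p * h = g" "p \<in> monics m"
  shows "h \<in> monics (k - m)" "m \<le> k"
proof -
  have "p * frob_poly h = p * h"
    using assms(1,3) frob_poly_mult[of p h] unfolding assms(2)[symmetric] monics_def by simp
  hence "frob_poly h = h" using monics_nonzero[OF assms(3)] by simp
  moreover have "h \<noteq> 0" "degree g = degree p + degree h"
    using monics_nonzero[OF assms(1)] assms(2)[symmetric] by (auto simp: degree_mult_eq)
  ultimately show "h \<in> monics (k - m)" "m \<le> k"
    using assms(1,3) assms(2)[symmetric] by (auto simp: monics_def lead_coeff_mult)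
qed

text \<open>For \<open>x \<in> Fix m\<close> this is the characteristic polynomial of x as an
  element of F_{q^m} over F_q.\<close>

definition conj_poly :: "'k \<Rightarrow> nat \<Rightarrow> 'k poly" where
  "conj_poly x m = (\<Prod>i<m. [:- (x ^ (q ^ i)), 1:])"

lemma conj_poly_nonzero: "conj_poly x m \<noteq> 0"
  by (simp add: conj_poly_def)

text \<open>The Frobenius map shifts the linear factors by one. Multiplying by the factor of index 0
  completes both sides to a product of \<open>Suc m\<close> factors, whose last one equals the first
  because \<open>x \<in> Fix m\<close>.\<close>

lemma conj_poly_monics:
  assumes "x \<in> Fix m"
  shows "conj_poly x m \<in> monics m"
proof -
  let ?l = "\<lambda>i. [:- (x ^ (q ^ i)), 1:]"
  have "?l 0 * frob_poly (conj_poly x m) = ?l 0 * (\<Prod>i<m. ?l (Suc i))"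
    by (simp add: conj_poly_def frob_poly_prod frob_poly_linear mult.commute flip: power_mult del: mult_pCons_left)
  also have "\<dots> = (\<Prod>i<Suc m. ?l i)"
    by (subst prod.lessThan_Suc_shift) simp
  also have "\<dots> = ?l 0 * conj_poly x m"
    using assms by (simp add: conj_poly_def Fix_def mult.commute del: mult_pCons_left mult_pCons_right)
  finally have "frob_poly (conj_poly x m) = conj_poly x m"
    by (subst (asm) mult_cancel_left) auto
  moreover have "degree (conj_poly x m) = m"
    unfolding conj_poly_def by (subst degree_prod_eq_sum_degree) auto
  moreover have "lead_coeff (conj_poly x m) = 1"
    unfolding conj_poly_def lead_coeff_prod by simp
  ultimately show ?thesis by (simp add: monics_def)
qed

text \<open>Applying \<open>frob_poly\<close> to \<open>g\<close>, written as a power of X - y times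
  a cofactor, exhibits the same power of X - y^q in \<open>g\<close>.\<close>

lemma order_le_order_frob:
  assumes "g \<in> monics k"
  shows "order x g \<le> order (x ^ (q ^ i)) g"
proof (induction i)
  case (Suc i)
  define y where "y = x ^ (q ^ i)"
  obtain h where h: "g = [:-y, 1:] ^ order y g * h"
    using order_1[of y g] by (auto elim: dvdE)
  have "g = frob_poly ([:-y, 1:] ^ order y g * h)"
    using h assms by (simp add: monics_def)
  hence "[:- (y ^ q), 1:] ^ order y g dvd g"
    by (metis dvd_triv_left frob_poly_linear frob_poly_mult frob_poly_power)
  hence "order y g \<le> order (y ^ q) g"
    using order_divides monics_nonzero[OF assms] by blast
  moreover have "y ^ q = x ^ (q ^ Suc i)" by (simp add: y_def mult.commute flip: power_mult)
  ultimately show ?case using Suc by (simp add: y_def)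
qed simp

text \<open>All conjugates of a root are roots, so two of them coincide; injectivity of the
  Frobenius map carries the coincidence back to x.\<close>

lemma root_periodic:
  assumes "g \<in> monics k" "poly g x = 0"
  shows "\<exists>e>0. x \<in> Fix e"
proof -
  have g0: "g \<noteq> 0" using monics_nonzero assms by blast
  have "(\<lambda>i. x ^ (q ^ i)) ` UNIV \<subseteq> {y. poly g y = 0}"
  proof
    fix y assume "y \<in> (\<lambda>i. x ^ (q ^ i)) ` UNIV"
    then obtain i where y: "y = x ^ (q ^ i)" by blast
    have "order x g > 0" using assms g0 by (simp add: order_root)
    hence "order y g > 0" using order_le_order_frob[OF assms(1), of x i] y by simp
    thus "y \<in> {y. poly g y = 0}" by (simp add: order_root)
  qed
  hence "finite ((\<lambda>i. x ^ (q ^ i)) ` UNIV)"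
    using poly_roots_finite[OF g0] finite_subset by blast
  hence "\<not> inj (\<lambda>i. x ^ (q ^ i))"
    using finite_imageD infinite_UNIV_nat by blast
  then obtain i j where ij: "i < j" "x ^ (q ^ i) = x ^ (q ^ j)"
    unfolding inj_def by (metis nat_neq_iff)
  have "(x ^ (q ^ (j - i))) ^ (q ^ i) = x ^ (q ^ i)"
    using ij by (simp flip: power_mult power_add)
  hence "x \<in> Fix (j - i)" using frob_inj by (simp add: Fix_def)
  thus ?thesis using ij by (intro exI[of _ "j - i"]) auto
qed

lemma Fix_diff_exponent:
  assumes "x \<in> Fix i" "x \<in> Fix j" "i \<le> j"
  shows "x \<in> Fix (j - i)"
proof -
  have "(x ^ (q ^ (j - i))) ^ (q ^ i) = x ^ (q ^ i)"
    using assms by (simp add: Fix_def flip: power_mult power_add)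
  thus ?thesis using frob_inj by (simp add: Fix_def)
qed

lemma conj_poly_add:
  assumes "x \<in> Fix i"
  shows "conj_poly x (i + j) = conj_poly x i * conj_poly x j"
proof (induction j)
  case (Suc j)
  have "x ^ (q ^ (i + j)) = (x ^ (q ^ i)) ^ (q ^ j)"
    by (simp add: power_add flip: power_mult)
  also have "\<dots> = x ^ (q ^ j)" using assms by (simp add: Fix_def)
  finally show ?case using Suc
    by (simp add: conj_poly_def mult.assoc del: mult_pCons_left mult_pCons_right)
qed (simp add: conj_poly_def)

lemma conj_poly_mult_exponent:
  assumes "x \<in> Fix e"
  shows "conj_poly x (e * j) = conj_poly x e ^ j"
proof (induction j)
  case (Suc j)
  thus ?case using conj_poly_add[OF assms, of "e * j"] by simp
qed (simp add: conj_poly_def)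

text \<open>
  If \<open>x\<close> has degree \<open>e\<close> over \<open>Fix 1\<close>, then \<open>x \<in> Fix m\<close> holds only for multiples \<open>m\<close> of \<open>e\<close>, and
  then \<open>conj_poly x m\<close> is the \<open>(m / e)\<close>-th power of the minimal polynomial of \<open>x\<close>.
\<close>

lemma card_conj_poly_dvd:
  assumes g: "g \<in> monics k" and root: "poly g x = 0"
  shows "card {m \<in> {1..k}. x \<in> Fix m \<and> conj_poly x m dvd g} = order x g"
proof -
  have g0: "g \<noteq> 0" using monics_nonzero g by blast
  define e where "e = (LEAST e. e > 0 \<and> x \<in> Fix e)"
  have e: "e > 0" "x \<in> Fix e"
    using LeastI_ex[of "\<lambda>e. e > 0 \<and> x \<in> Fix e"] root_periodic[OF g root] unfolding e_def by blast+
  have least: "e \<le> m" if "m > 0" "x \<in> Fix m" for m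
    unfolding e_def using that by (intro Least_le) auto
  have mult: "e dvd m" if "x \<in> Fix m" for m
  proof (rule ccontr)
    assume "\<not> e dvd m"
    hence "m mod e > 0" by (simp add: dvd_eq_mod_eq_0)
    moreover have "x \<in> Fix (m - e * (m div e))"
      using that e by (intro Fix_diff_exponent Fix_mult_exponent) auto
    hence "x \<in> Fix (m mod e)" by (simp add: minus_mult_div_eq_mod)
    ultimately have "e \<le> m mod e" by (rule least)
    thus False using e(1) mod_less_divisor[of e m] by linarith
  qed
  have inj: "inj_on (\<lambda>i. x ^ (q ^ i)) {..<e}"
  proof (rule linorder_inj_onI)
    fix i j assume ij: "i < j" "i \<in> {..<e}" "j \<in> {..<e}"
    show "x ^ (q ^ i) \<noteq> x ^ (q ^ j)"
    proof
      assume eq: "x ^ (q ^ i) = x ^ (q ^ j)"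
      have "(x ^ (q ^ (j - i))) ^ (q ^ i) = x ^ (q ^ i)"
        using ij eq by (simp flip: power_mult power_add)
      hence "x \<in> Fix (j - i)" using frob_inj by (simp add: Fix_def)
      hence "e \<le> j - i" using ij by (intro least) auto
      thus False using ij by simp
    qed
  qed auto
  define C where "C = (\<lambda>i. x ^ (q ^ i)) ` {..<e}"
  have xC: "x \<in> C" unfolding C_def using e(1) by (intro image_eqI[of _ _ 0]) auto
  have "conj_poly x e = (\<Prod>y\<in>C. [:-y, 1:])"
    unfolding C_def conj_poly_def by (subst prod.reindex[OF inj]) simp
  also have "\<dots> = (\<Prod>y\<in>#mset_set C. [:-y, 1:])" by (simp add: prod_unfold_prod_mset)
  finally have "proots (conj_poly x e) = mset_set C" by (simp only: proots_prod_linear)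
  hence "order y (conj_poly x e) = count (mset_set C) y" for y
    using conj_poly_nonzero[of x e] by (metis count_proots)
  hence order_conj: "order y (conj_poly x e) = (if y \<in> C then 1 else 0)" for y
    by (simp add: C_def)
  have order_conj_power: "order y (conj_poly x e ^ j) = (if y \<in> C then j else 0)" for y j
    using order_conj[of y] conj_poly_nonzero[of x e]
    by (induction j) (auto simp: order_mult)
  \<comment> \<open>Multiplicities do not decrease from x to its conjugates, so the condition at x
    implies the one at every point of \<open>C\<close>.\<close>
  have dvd_iff: "conj_poly x (e * j) dvd g \<longleftrightarrow> j \<le> order x g" for j
  proof -
    have "conj_poly x (e * j) dvd g \<longleftrightarrow> (\<forall>y. order y (conj_poly x e ^ j) \<le> order y g)"
      unfolding conj_poly_mult_exponent[OF e(2)]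
      using conj_poly_nonzero g0 by (intro dvd_iff_order_le) auto
    also have "\<dots> \<longleftrightarrow> (\<forall>y\<in>C. j \<le> order y g)" by (auto simp: order_conj_power)
    also have "\<dots> \<longleftrightarrow> j \<le> order x g"
      using xC order_le_order_frob[OF g, of x] by (auto simp: C_def intro: le_trans)
    finally show ?thesis .
  qed
  \<comment> \<open>A divisor of \<open>g\<close> has degree at most k, so the range
    \<open>{1..k}\<close> cuts off none of these multiples of \<open>e\<close>.\<close>
  have "{m \<in> {1..k}. x \<in> Fix m \<and> conj_poly x m dvd g} = (\<lambda>j. e * j) ` {1..order x g}"
  proof (intro equalityI subsetI)
    fix m assume m: "m \<in> {m \<in> {1..k}. x \<in> Fix m \<and> conj_poly x m dvd g}"
    then obtain j where "m = e * j" using mult by blast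
    thus "m \<in> (\<lambda>j. e * j) ` {1..order x g}"
      using m dvd_iff[of j] by (intro image_eqI[of _ _ j]) (auto simp: Suc_le_eq)
  next
    fix m assume "m \<in> (\<lambda>j. e * j) ` {1..order x g}"
    then obtain j where "j \<in> {1..order x g}" and j: "m = e * j" by blast
    hence j: "m = e * j" "1 \<le> j" "j \<le> order x g" by auto
    have Fix: "x \<in> Fix m" unfolding j(1) by (rule Fix_mult_exponent[OF e(2)])
    have dvd: "conj_poly x m dvd g" unfolding j(1) using dvd_iff j by blast
    then obtain h where "conj_poly x m * h = g" by (metis dvdE)
    hence "m \<le> k" using monics_divide(2)[OF g _ conj_poly_monics[OF Fix]] by blast
    thus "m \<in> {m \<in> {1..k}. x \<in> Fix m \<and> conj_poly x m dvd g}"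
      using Fix dvd j e(1) by auto
  qed
  hence "card {m \<in> {1..k}. x \<in> Fix m \<and> conj_poly x m dvd g} = card ((\<lambda>j. e * j) ` {1..order x g})"
    by (simp only:)
  also have "\<dots> = order x g" using e(1) by (subst card_image) (auto simp: inj_on_def)
  finally show ?thesis .
qed

text \<open>Counting the pairs (m, x) by x instead of m, each root of \<open>g\<close> contributes
  its multiplicity, and the multiplicities add up to the degree.\<close>

lemma sum_card_conj_poly_dvd:
  assumes g: "g \<in> monics k"
  shows "(\<Sum>m=1..k. card {x \<in> Fix m. conj_poly x m dvd g}) = k"
proof -
  define pts where "pts = {x. poly g x = 0}"
  have fin_pts: "finite pts" unfolding pts_def using monics_nonzero[OF g] by (rule poly_roots_finite)
  have "{x \<in> Fix m. conj_poly x m dvd g} = {x \<in> pts. x \<in> Fix m \<and> conj_poly x m dvd g}"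
    if "m \<in> {1..k}" for m
  proof -
    have "poly g x = 0" if "conj_poly x m dvd g" for x
    proof -
      have "0 < m" using \<open>m \<in> {1..k}\<close> by simp
      hence "poly (conj_poly x m) x = 0"
        by (auto simp: conj_poly_def poly_prod intro!: bexI[of _ 0])
      thus ?thesis using that by (meson dvd_trans poly_eq_0_iff_dvd)
    qed
    thus ?thesis by (auto simp: pts_def)
  qed
  hence "(\<Sum>m=1..k. card {x \<in> Fix m. conj_poly x m dvd g}) =
         (\<Sum>m=1..k. card {x \<in> pts. x \<in> Fix m \<and> conj_poly x m dvd g})" by (intro sum.cong) auto
  also have "\<dots> = (\<Sum>m=1..k. \<Sum>x\<in>pts. if x \<in> Fix m \<and> conj_poly x m dvd g then 1 else 0)"
    using fin_pts by (simp add: sum.inter_filter[symmetric])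
  also have "\<dots> = (\<Sum>x\<in>pts. \<Sum>m=1..k. if x \<in> Fix m \<and> conj_poly x m dvd g then 1 else 0)"
    by (rule sum.swap)
  also have "\<dots> = (\<Sum>x\<in>pts. card {m \<in> {1..k}. x \<in> Fix m \<and> conj_poly x m dvd g})"
    by (simp add: sum.inter_filter[symmetric])
  also have "\<dots> = (\<Sum>x\<in>pts. order x g)"
    by (intro sum.cong refl card_conj_poly_dvd[OF g]) (simp add: pts_def)
  also have "\<dots> = degree g" unfolding pts_def using monics_nonzero[OF g] by (rule sum_order_eq_degree)
  also have "\<dots> = k" using g by (simp add: monics_def)
  finally show ?thesis .
qed

text \<open>This is the logarithmic derivative of an L-series, read off at T^k. In place of an Euler
  product over irreducible polynomials, the factor k is written as the number of pairs (m, x) with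
  \<open>conj_poly x m dvd g\<close>; dividing \<open>g\<close> by \<open>conj_poly x m\<close>
  leaves an arbitrary monic polynomial of degree k - m.\<close>

lemma newton_identity:
  fixes L :: "'k poly \<Rightarrow> complex"
  assumes mult: "\<And>g h k l. g \<in> monics k \<Longrightarrow> h \<in> monics l \<Longrightarrow> L (g * h) = L g * L h"
  shows "of_nat k * (\<Sum>g\<in>monics k. L g) =
    (\<Sum>m=1..k. (\<Sum>x\<in>Fix m. L (conj_poly x m)) * (\<Sum>g\<in>monics (k - m). L g))"
proof -
  have inner: "(\<Sum>g\<in>{g \<in> monics k. conj_poly x m dvd g}. L g) =
      L (conj_poly x m) * (\<Sum>g\<in>monics (k - m). L g)"
    if "x \<in> Fix m" "m \<le> k" for x m
  proof -
    have c: "conj_poly x m \<in> monics m" by (rule conj_poly_monics) fact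
    have "{g \<in> monics k. conj_poly x m dvd g} = (\<lambda>h. conj_poly x m * h) ` monics (k - m)"
      using monics_divide(1)[OF _ _ c] monics_mult[OF c, of _ "k - m"] that(2) by (auto elim!: dvdE)
    moreover have "inj_on (\<lambda>h. conj_poly x m * h) (monics (k - m))"
      using conj_poly_nonzero by (auto simp: inj_on_def)
    ultimately show ?thesis
      using mult[OF c] by (simp add: sum.reindex sum_distrib_left)
  qed
  have "of_nat k * (\<Sum>g\<in>monics k. L g) =
      (\<Sum>g\<in>monics k. of_nat (\<Sum>m=1..k. card {x \<in> Fix m. conj_poly x m dvd g}) * L g)"
    by (simp only: sum_distrib_left sum_card_conj_poly_dvd cong: sum.cong)
  also have "\<dots> = (\<Sum>g\<in>monics k. \<Sum>m=1..k. \<Sum>x\<in>Fix m. if conj_poly x m dvd g then L g else 0)"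
  proof (rule sum.cong[OF refl])
    fix g assume "g \<in> monics k"
    have "of_nat (card {x \<in> Fix m. conj_poly x m dvd g}) * L g =
        (\<Sum>x\<in>Fix m. if conj_poly x m dvd g then L g else 0)" if "m \<in> {1..k}" for m
      using finite_Fix[of m] that by (subst sum.If_cases) (auto simp: Int_def)
    thus "of_nat (\<Sum>m=1..k. card {x \<in> Fix m. conj_poly x m dvd g}) * L g =
        (\<Sum>m=1..k. \<Sum>x\<in>Fix m. if conj_poly x m dvd g then L g else 0)"
      by (simp add: sum_distrib_right)
  qed
  also have "\<dots> = (\<Sum>m=1..k. \<Sum>x\<in>Fix m. \<Sum>g\<in>monics k. if conj_poly x m dvd g then L g else 0)"
    by (subst sum.swap, rule sum.cong[OF refl], rule sum.swap)
  also have "\<dots> = (\<Sum>m=1..k. \<Sum>x\<in>Fix m. \<Sum>g\<in>{g \<in> monics k. conj_poly x m dvd g}. L g)"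
    using finite_monics[of k] by (simp add: sum.inter_filter)
  also have "\<dots> = (\<Sum>m=1..k. (\<Sum>x\<in>Fix m. L (conj_poly x m)) * (\<Sum>g\<in>monics (k - m). L g))"
    by (intro sum.cong refl) (simp add: inner sum_distrib_right)
  finally show ?thesis .
qed

end

section \<open>Character sums of \<open>a x^4 + b x^2\<close>\<close>

locale additive_character = artin_schreier q n f
  for q n :: nat and f :: "'k::alg_closed_field poly" +
  fixes \<psi> :: "'k \<Rightarrow> complex"
  assumes \<psi>_add: "\<And>x y. x \<in> Fix 1 \<Longrightarrow> y \<in> Fix 1 \<Longrightarrow> \<psi> (x + y) = \<psi> x * \<psi> y"
    and norm_\<psi>: "\<And>x. x \<in> Fix 1 \<Longrightarrow> cmod (\<psi> x) = 1"
    and \<psi>_nontrivial: "\<exists>x\<in>Fix 1. \<psi> x \<noteq> 1"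
begin

lemma \<psi>_0: "\<psi> 0 = 1"
proof -
  have "\<psi> 0 * \<psi> 0 = \<psi> 0 * 1" using \<psi>_add[of 0 0] by simp
  moreover have "\<psi> 0 \<noteq> 0" using norm_\<psi>[of 0] by auto
  ultimately show ?thesis using mult_left_cancel by blast
qed

lemma sum_\<psi>_eq_0: "(\<Sum>x\<in>Fix 1. \<psi> x) = 0"
proof -
  obtain y where y: "y \<in> Fix 1" "\<psi> y \<noteq> 1" using \<psi>_nontrivial by blast
  have "bij_betw (\<lambda>x. y + x) (Fix 1) (Fix 1)"
    by (rule bij_betwI[of _ _ _ "\<lambda>x. x - y"]) (use y in auto)
  hence "(\<Sum>x\<in>Fix 1. \<psi> x) = (\<Sum>x\<in>Fix 1. \<psi> (y + x))"
    by (rule sum.reindex_bij_betw[symmetric])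
  also have "\<dots> = \<psi> y * (\<Sum>x\<in>Fix 1. \<psi> x)"
    using y by (simp add: \<psi>_add sum_distrib_left del: One_nat_def)
  finally show ?thesis using y(2) by (simp del: One_nat_def)
qed

definition char_sum :: "nat \<Rightarrow> complex" where
  "char_sum m = (\<Sum>x\<in>Fix m. \<psi> (trace m (poly f x)))"

text \<open>
  The upper bounds for the fibers of the trace add up to \<open>q^(2r) + O(q^r)\<close>; as the fibers
  partition \<open>Fix (2 * r)\<close>, they also yield lower bounds.
\<close>

lemma char_sum_bound:
  fixes r :: nat
  defines "R \<equiv> q ^ r" and "e \<equiv> degree f * q"
  assumes r: "r > 0" and large: "R > e * e + 4 * e + 2"
  shows "cmod (char_sum (2 * r)) \<le> (4 * real e + 4) * real R"
proof -
  define m where "m = 2 * r"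
  have m: "m > 0" using r by (simp add: m_def)
  define N where "N \<gamma> = card {x \<in> Fix m. trace m (poly f x) = \<gamma>}" for \<gamma>
  \<comment> \<open>The deviation, scaled by q, of a fiber from the average size R^2 / q.\<close>
  define \<delta> where "\<delta> \<gamma> = real q * real (N \<gamma>) - real (R * R)" for \<gamma>
  define C where "C = (2 * real e + 2) * real R"
  have tr: "(\<lambda>x. trace m (poly f x)) ` Fix m \<subseteq> Fix 1"
    using trace_Fix poly_f_Fix by blast
  have fin1: "finite (Fix 1)" by (rule finite_Fix) simp
  have RR: "q ^ m = R * R" by (simp add: m_def R_def power_add mult_2)
  have \<delta>_le: "\<delta> \<gamma> \<le> C" if "\<gamma> \<in> Fix 1" for \<gamma>
  proof -
    have "q * N \<gamma> \<le> R * R + (2 * e + 2) * R"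
      unfolding N_def m_def R_def e_def
      using card_trace_fiber_le[OF r _ that] large unfolding R_def e_def by blast
    hence "real (q * N \<gamma>) \<le> real (R * R + (2 * e + 2) * R)" by (rule of_nat_mono)
    thus ?thesis by (simp add: \<delta>_def C_def algebra_simps)
  qed
  have "(\<Sum>\<gamma>\<in>Fix 1. N \<gamma>) = card (Fix m)"
  proof -
    have "(\<Sum>\<gamma>\<in>Fix 1. \<Sum>x\<in>{x \<in> Fix m. trace m (poly f x) = \<gamma>}. 1) = (\<Sum>x\<in>Fix m. 1 :: nat)"
      by (rule sum.group[OF finite_Fix[OF m] fin1 tr])
    thus ?thesis by (simp add: N_def)
  qed
  also have "\<dots> = R * R" using card_Fix[OF m] RR by simp
  finally have "(\<Sum>\<gamma>\<in>Fix 1. real (N \<gamma>)) = real (R * R)" by (metis of_nat_sum)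
  hence sum_\<delta>: "(\<Sum>\<gamma>\<in>Fix 1. \<delta> \<gamma>) = 0"
    using card_Fix[of 1] by (simp add: \<delta>_def sum_subtractf flip: sum_distrib_left)
  have "char_sum m = (\<Sum>\<gamma>\<in>Fix 1. \<Sum>x\<in>{x \<in> Fix m. trace m (poly f x) = \<gamma>}. \<psi> (trace m (poly f x)))"
    unfolding char_sum_def by (rule sum.group[OF finite_Fix[OF m] fin1 tr, symmetric])
  also have "\<dots> = (\<Sum>\<gamma>\<in>Fix 1. of_nat (N \<gamma>) * \<psi> \<gamma>)"
    by (simp add: N_def)
  finally have "of_nat q * char_sum m = (\<Sum>\<gamma>\<in>Fix 1. of_nat q * of_nat (N \<gamma>) * \<psi> \<gamma>)"
    by (simp add: sum_distrib_left mult.assoc)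
  also have "\<dots> = (\<Sum>\<gamma>\<in>Fix 1. of_real (\<delta> \<gamma>) * \<psi> \<gamma>) + of_nat (R * R) * (\<Sum>\<gamma>\<in>Fix 1. \<psi> \<gamma>)"
    by (simp add: \<delta>_def sum_distrib_left sum.distrib[symmetric] algebra_simps)
  also have "(\<Sum>\<gamma>\<in>Fix 1. \<psi> \<gamma>) = 0" by (rule sum_\<psi>_eq_0)
  finally have "real q * cmod (char_sum m) = cmod (\<Sum>\<gamma>\<in>Fix 1. of_real (\<delta> \<gamma>) * \<psi> \<gamma>)"
    by (metis add_0_right mult_zero_right norm_mult norm_of_nat)
  also have "\<dots> \<le> (\<Sum>\<gamma>\<in>Fix 1. \<bar>\<delta> \<gamma>\<bar>)"
    by (rule sum_norm_le) (simp add: norm_mult norm_\<psi> del: One_nat_def)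
  \<comment> \<open>One-sided bounds suffice: from \<open>\<delta> \<gamma> \<le> C\<close> and
    \<open>C \<ge> 0\<close> each absolute value is at most
    \<open>2 * C - \<delta> \<gamma>\<close>, and the deviations sum to 0.\<close>
  also have "\<dots> \<le> (\<Sum>\<gamma>\<in>Fix 1. 2 * C - \<delta> \<gamma>)"
  proof (rule sum_mono)
    fix \<gamma> :: 'k assume "\<gamma> \<in> Fix 1"
    moreover have "C \<ge> 0" by (simp add: C_def)
    ultimately show "\<bar>\<delta> \<gamma>\<bar> \<le> 2 * C - \<delta> \<gamma>" using \<delta>_le[of \<gamma>] by linarith
  qed
  also have "\<dots> = real q * (2 * C)"
    using card_Fix[of 1] sum_\<delta> by (simp add: sum_subtractf)
  finally have "cmod (char_sum m) \<le> 2 * C" by simp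
  thus ?thesis by (simp add: C_def m_def algebra_simps)
qed

end

locale quartic_sum = additive_character q n f \<psi>
  for q n :: nat and f :: "'k::alg_closed_field poly" and \<psi> +
  fixes a b :: 'k
  assumes f_eq: "f = [:0, 0, b, 0, a:]" and two_nonzero: "(2::'k) \<noteq> 0"
begin

text \<open>
  For a monic polynomial, \<open>root_sum\<close> is the sum of \<open>a y^4 + b y^2\<close> over its roots \<open>y\<close>, with the
  power sums expressed by the elementary symmetric functions, i.e. by the leading coefficients.
\<close>

definition root_sum :: "'k poly \<Rightarrow> 'k" where
  "root_sum g = (let c = coeff (reflect_poly g) in
     a * (c 1 ^ 4 - 4 * c 1 ^ 2 * c 2 + 2 * c 2 ^ 2 + 4 * c 1 * c 3 - 4 * c 4) + b * (c 1 ^ 2 - 2 * c 2))"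

text \<open>Power sums add over the roots of a product; in terms of coefficients this is a
  polynomial identity. The coefficients differ from the elementary symmetric functions by signs,
  which cancel because all terms of the formulas have weight 4 or 2.\<close>

lemma root_sum_mult:
  assumes "lead_coeff g = 1" "lead_coeff h = 1"
  shows "root_sum (g * h) = root_sum g + root_sum h"
proof -
  define c where "c = coeff (reflect_poly g)"
  define c' where "c' = coeff (reflect_poly h)"
  have c0: "c 0 = 1" "c' 0 = 1" using assms by (simp_all add: c_def c'_def)
  define C where "C = coeff (reflect_poly (g * h))"
  have C: "C k = (\<Sum>i\<le>k. c i * c' (k - i))" for k
    by (simp add: C_def reflect_poly_mult coeff_mult c_def c'_def)
  have C': "C 1 = c 1 + c' 1" "C 2 = c 2 + c 1 * c' 1 + c' 2"
    "C 3 = c 3 + c 2 * c' 1 + c 1 * c' 2 + c' 3"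
    "C 4 = c 4 + c 3 * c' 1 + c 2 * c' 2 + c 1 * c' 3 + c' 4"
    unfolding C by (simp_all add: c0 eval_nat_numeral)
  have "root_sum (g * h) = a * (C 1 ^ 4 - 4 * C 1 ^ 2 * C 2 + 2 * C 2 ^ 2 + 4 * C 1 * C 3 - 4 * C 4)
      + b * (C 1 ^ 2 - 2 * C 2)"
    by (simp add: root_sum_def C_def Let_def)
  also have "\<dots> = (a * (c 1 ^ 4 - 4 * c 1 ^ 2 * c 2 + 2 * c 2 ^ 2 + 4 * c 1 * c 3 - 4 * c 4)
      + b * (c 1 ^ 2 - 2 * c 2)) +
      (a * (c' 1 ^ 4 - 4 * c' 1 ^ 2 * c' 2 + 2 * c' 2 ^ 2 + 4 * c' 1 * c' 3 - 4 * c' 4)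
      + b * (c' 1 ^ 2 - 2 * c' 2))"
    unfolding C' by (simp add: algebra_simps eval_nat_numeral)
  finally show ?thesis by (simp add: root_sum_def c_def c'_def Let_def)
qed

lemma root_sum_1: "root_sum 1 = 0"
  by (simp add: root_sum_def coeff_1)

lemma poly_f: "poly f y = a * y ^ 4 + b * y ^ 2"
  by (simp add: f_eq algebra_simps eval_nat_numeral)

lemma root_sum_linear: "root_sum [:-y, 1:] = poly f y"
proof -
  have "coeff (reflect_poly [:-y, 1:]) 1 = -y"
    "coeff (reflect_poly [:-y, 1:]) 2 = 0" "coeff (reflect_poly [:-y, 1:]) 3 = 0"
    "coeff (reflect_poly [:-y, 1:]) 4 = 0"
    by (simp_all add: coeff_reflect_poly)
  thus ?thesis by (simp add: root_sum_def poly_f Let_def)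
qed

lemma root_sum_prod_linear: "root_sum (\<Prod>i<m. [:- y i, 1:]) = (\<Sum>i<(m::nat). poly f (y i))"
proof (induction m)
  case (Suc m)
  have "root_sum ((\<Prod>i<m. [:- y i, 1:]) * [:- y m, 1:]) =
      root_sum (\<Prod>i<m. [:- y i, 1:]) + root_sum [:- y m, 1:]"
    by (rule root_sum_mult) (auto simp: lead_coeff_prod)
  thus ?case using Suc by (simp add: root_sum_linear del: mult_pCons_left mult_pCons_right)
qed (simp add: root_sum_1)

text \<open>As \<open>f\<close> has coefficients in F_q, its values at the conjugates of x are the
  conjugates of f(x). This turns the inner sums of \<open>newton_identity\<close> into
  \<open>char_sum m\<close>.\<close>

lemma root_sum_conj_poly: "root_sum (conj_poly x m) = trace m (poly f x)"
  unfolding conj_poly_def root_sum_prod_linear trace_def by (simp add: poly_f_frob)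

lemma a_Fix: "a \<in> Fix 1" and b_Fix: "b \<in> Fix 1"
proof -
  have "coeff f 4 = a" "coeff f 2 = b"
    unfolding f_eq by (simp_all add: eval_nat_numeral)
  thus "a \<in> Fix 1" "b \<in> Fix 1" using coeff_f_Fix by metis+
qed

lemma coeff_reflect_Fix:
  assumes "g \<in> monics k"
  shows "coeff (reflect_poly g) i \<in> Fix 1"
  unfolding coeff_reflect_poly using monics_coeff[OF assms] Fix_0 by presburger

lemma root_sum_Fix: "g \<in> monics k \<Longrightarrow> root_sum g \<in> Fix 1"
  unfolding root_sum_def Let_def
  by (intro Fix_add Fix_diff Fix_mult Fix_power a_Fix b_Fix coeff_reflect_Fix Fix_numeral)

text \<open>The coefficient of T^k in the L-function, that is, in the formal series exp (\<Sum>m.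
  char_sum m * T^m / m).\<close>

definition L_coeff :: "nat \<Rightarrow> complex" where
  "L_coeff k = (\<Sum>g\<in>monics k. \<psi> (root_sum g))"

lemma L_coeff_0: "L_coeff 0 = 1"
  by (simp add: L_coeff_def monics_0 root_sum_1 \<psi>_0)

lemma newton_char_sum:
  "of_nat k * L_coeff k = (\<Sum>m=1..k. char_sum m * L_coeff (k - m))"
proof -
  have "\<psi> (root_sum (g * h)) = \<psi> (root_sum g) * \<psi> (root_sum h)"
    if "g \<in> monics i" "h \<in> monics j" for g h i j
  proof -
    have "root_sum (g * h) = root_sum g + root_sum h"
      using that by (intro root_sum_mult) (auto simp: monics_def)
    thus ?thesis using \<psi>_add root_sum_Fix that by simp
  qed
  from newton_identity[of "\<lambda>g. \<psi> (root_sum g)" k, OF this] show ?thesis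
    by (simp add: L_coeff_def char_sum_def root_sum_conj_poly)
qed

text \<open>
  Adding a term \<open>t x^(k-4)\<close> (or \<open>t x^(k-2)\<close> if \<open>a = 0\<close>) permutes the monic polynomials of degree
  \<open>k\<close> and multiplies the summands of \<open>L_coeff k\<close> by a constant factor, which can be chosen different from 1.
\<close>

lemma L_coeff_eq_0_aux:
  assumes j: "0 < j" "j \<le> k" and s: "s \<noteq> 0" "s \<in> Fix 1"
    and shift: "\<And>g t. g \<in> monics k \<Longrightarrow> root_sum (g + monom t (k - j)) = root_sum g + s * t"
  shows "L_coeff k = 0"
proof -
  obtain y where y: "y \<in> Fix 1" "\<psi> y \<noteq> 1" using \<psi>_nontrivial by blast
  define t where "t = y / s"
  have t: "t \<in> Fix 1" "s * t = y"
    using y s by (auto simp: t_def Fix_def power_divide)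
  have mon: "g + monom u (k - j) \<in> monics k" if "g \<in> monics k" "u \<in> Fix 1" for g u
  proof -
    have "degree (g + monom u (k - j)) = k"
    proof -
      have "degree (monom u (k - j)) < degree g"
        using degree_monom_le[of u "k - j"] j that(1) by (auto simp: monics_def)
      thus ?thesis using that(1) by (simp add: degree_add_eq_left monics_def)
    qed
    moreover have "coeff (g + monom u (k - j)) k = 1"
      using that(1) j by (auto simp: monics_def)
    moreover have "frob_poly (g + monom u (k - j)) = g + monom u (k - j)"
      unfolding frob_poly_iff using monics_coeff[OF that(1)] that(2) Fix_0
      by (auto simp: coeff_monom simp del: One_nat_def intro!: Fix_add)
    ultimately show ?thesis by (simp add: monics_def)
  qed
  have "bij_betw (\<lambda>g. g + monom t (k - j)) (monics k) (monics k)"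
  proof (rule bij_betwI[of _ _ _ "\<lambda>g. g + monom (- t) (k - j)"])
    show "(\<lambda>g. g + monom t (k - j)) \<in> monics k \<rightarrow> monics k" using mon t by auto
    show "(\<lambda>g. g + monom (-t) (k - j)) \<in> monics k \<rightarrow> monics k" using mon t by auto
  qed (simp_all add: add_monom add.assoc)
  hence "L_coeff k = (\<Sum>g\<in>monics k. \<psi> (root_sum (g + monom t (k - j))))"
    unfolding L_coeff_def by (rule sum.reindex_bij_betw[symmetric])
  also have "\<dots> = (\<Sum>g\<in>monics k. \<psi> (root_sum g) * \<psi> y)"
    by (intro sum.cong refl) (simp add: shift t(2) \<psi>_add root_sum_Fix y del: One_nat_def)
  also have "\<dots> = L_coeff k * \<psi> y" by (simp add: L_coeff_def sum_distrib_right)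
  finally show ?thesis using y(2) by simp
qed

lemma coeff_reflect_shift:
  assumes "g \<in> monics k" "0 < j" "j \<le> k"
  shows "coeff (reflect_poly (g + monom t (k - j))) i = coeff (reflect_poly g) i + (if i = j then t else 0)"
proof -
  have "degree (monom t (k - j)) < degree g"
    using degree_monom_le[of t "k - j"] assms by (auto simp: monics_def)
  hence "degree (g + monom t (k - j)) = k"
    using assms(1) by (simp add: degree_add_eq_left monics_def)
  thus ?thesis using assms by (auto simp: coeff_reflect_poly monics_def)
qed

text \<open>In \<open>root_sum\<close> the coefficient c 4 occurs only linearly, with factor -4a;
  for a = 0 the same holds of c 2, with factor -2b. These factors are nonzero in odd characteristic,
  and c 4 can be varied freely once k is at least 4.\<close>

lemma L_coeff_eq_0:
  assumes "k \<ge> 4"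
  shows "L_coeff k = 0"
proof (cases "a = 0")
  case False
  have "(4::'k) = 2 * 2" by simp
  hence 4: "(4::'k) \<noteq> 0" using two_nonzero by (metis mult_eq_0_iff)
  show ?thesis
  proof (rule L_coeff_eq_0_aux[of 4 k "- (4 * a)"])
    show "- (4 * a) \<in> Fix 1" by (intro Fix_minus Fix_mult a_Fix Fix_numeral)
    fix g :: "'k poly" and t assume g: "g \<in> monics k"
    show "root_sum (g + monom t (k - 4)) = root_sum g + - (4 * a) * t"
      using assms by (simp add: root_sum_def coeff_reflect_shift[OF g] Let_def algebra_simps)
  qed (use assms False 4 in auto)
next
  case True
  hence b: "b \<noteq> 0" using degree_f_pos by (auto simp: f_eq)
  show ?thesis
  proof (rule L_coeff_eq_0_aux[of 2 k "- (2 * b)"])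
    show "- (2 * b) \<in> Fix 1" by (intro Fix_minus Fix_mult b_Fix Fix_numeral)
    fix g :: "'k poly" and t assume g: "g \<in> monics k"
    show "root_sum (g + monom t (k - 2)) = root_sum g + - (2 * b) * t"
      unfolding root_sum_def Let_def
      using assms by (simp add: coeff_reflect_shift[OF g] True algebra_simps)
  qed (use assms b two_nonzero in auto)
qed

end

section \<open>Bounded power sums\<close>

text \<open>A sequence in a compact set has two members that are arbitrarily close; dividing one by
  the other gives a common exponent at which all three powers are close to 1. Restricting to
  multiples of \<open>K = Suc N\<close> makes this exponent at least N.\<close>

lemma unit_powers_near_1:
  fixes u1 u2 u3 :: complex
  assumes "cmod u1 = 1" "cmod u2 = 1" "cmod u3 = 1" "\<epsilon> > 0"
  shows "\<exists>r\<ge>N. cmod (u1 ^ r - 1) < \<epsilon> \<and> cmod (u2 ^ r - 1) < \<epsilon> \<and> cmod (u3 ^ r - 1) < \<epsilon>"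
proof -
  define K where "K = Suc N"
  define V where "V k = (u1 ^ (K * k), u2 ^ (K * k), u3 ^ (K * k))" for k
  have "range V \<subseteq> cball 0 1 \<times> cball 0 1 \<times> cball 0 1"
    using assms by (auto simp: V_def norm_power)
  hence "bounded (range V)"
    by (rule bounded_subset[rotated]) (intro bounded_Times bounded_cball)
  then obtain l s where s: "strict_mono s" "(V \<circ> s) \<longlonglongrightarrow> l"
    using bounded_imp_convergent_subsequence by blast
  have "Cauchy (V \<circ> s)" using s(2) by (rule LIMSEQ_imp_Cauchy)
  then obtain M where M: "\<And>i j. i \<ge> M \<Longrightarrow> j \<ge> M \<Longrightarrow> dist ((V \<circ> s) i) ((V \<circ> s) j) < \<epsilon>"
    using assms(4) unfolding Cauchy_def by blast
  define i j where "i = s M" and "j = s (Suc M)"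
  have ij: "i < j" using s(1) by (simp add: i_def j_def strict_mono_def)
  have d: "dist (V i) (V j) < \<epsilon>" using M[of M "Suc M"] by (simp add: i_def j_def)
  have near: "cmod (u ^ (K * (j - i)) - 1) < \<epsilon>"
    if "cmod u = 1" "dist (u ^ (K * i)) (u ^ (K * j)) < \<epsilon>" for u
  proof -
    have "u ^ (K * j) = u ^ (K * i) * u ^ (K * (j - i))"
      using ij by (simp flip: power_add add: distrib_left[symmetric])
    hence "u ^ (K * j) - u ^ (K * i) = u ^ (K * i) * (u ^ (K * (j - i)) - 1)"
      by (simp add: algebra_simps)
    hence "cmod (u ^ (K * (j - i)) - 1) = dist (u ^ (K * j)) (u ^ (K * i))"
      using that(1) by (simp add: dist_norm norm_mult norm_power)
    thus ?thesis using that(2) by (simp add: dist_commute)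
  qed
  have "dist (u1 ^ (K * i)) (u1 ^ (K * j)) \<le> dist (V i) (V j)"
    using dist_fst_le[of "V i" "V j"] by (simp add: V_def)
  moreover have "dist (snd (V i)) (snd (V j)) \<le> dist (V i) (V j)" by (rule dist_snd_le)
  moreover have "dist (u2 ^ (K * i)) (u2 ^ (K * j)) \<le> dist (snd (V i)) (snd (V j))"
    using dist_fst_le[of "snd (V i)" "snd (V j)"] by (simp add: V_def)
  moreover have "dist (u3 ^ (K * i)) (u3 ^ (K * j)) \<le> dist (snd (V i)) (snd (V j))"
    using dist_snd_le[of "snd (V i)" "snd (V j)"] by (simp add: V_def)
  moreover have "K * (j - i) \<ge> K * 1" using ij by (intro mult_le_mono) auto
  ultimately show ?thesis
    using near assms d by (intro exI[of _ "K * (j - i)"]) (auto simp: K_def)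
qed

text \<open>Cancellation between the three powers is excluded along exponents at which all the unit
  parts are close to 1: there each power has real part at least half its modulus.\<close>

lemma bounded_power_sums_imp_norm_le_1:
  fixes z1 z2 z3 :: complex
  assumes bound: "\<And>r. r \<ge> r0 \<Longrightarrow> cmod (z1 ^ r + z2 ^ r + z3 ^ r) \<le> C"
  shows "cmod z1 \<le> 1"
proof (rule ccontr)
  assume "\<not> cmod z1 \<le> 1"
  hence "cmod z1 > 1" by simp
  then obtain N where N: "2 * C < cmod z1 ^ N"
    using real_arch_pow by blast
  \<comment> \<open>The value 1 at z = 0 keeps \<open>u z\<close> of modulus 1, so that
    \<open>unit_powers_near_1\<close> also applies if some of the numbers vanish.\<close>
  define u where "u z = (if z = 0 then 1 else sgn z)" for z :: complex
  have u: "cmod (u z) = 1" "z = of_real (cmod z) * u z" for z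
    by (auto simp: u_def sgn_eq norm_divide)
  obtain r where r: "r \<ge> max N r0" "cmod (u z1 ^ r - 1) < 1/2" "cmod (u z2 ^ r - 1) < 1/2"
    "cmod (u z3 ^ r - 1) < 1/2"
    using unit_powers_near_1[OF u(1)[of z1] u(1)[of z2] u(1)[of z3], of "1/2" "max N r0"] by auto
  have Re: "Re (z ^ r) \<ge> cmod z ^ r / 2" if "cmod (u z ^ r - 1) < 1/2" for z
  proof -
    have "z ^ r = of_real (cmod z ^ r) * u z ^ r"
      by (subst u(2)) (simp add: power_mult_distrib)
    hence "Re (z ^ r) = cmod z ^ r * Re (u z ^ r)" by (simp del: of_real_power)
    moreover have "\<bar>Re (u z ^ r - 1)\<bar> < 1/2" using that abs_Re_le_cmod le_less_trans by blast
    hence "Re (u z ^ r) \<ge> 1/2" by (simp only: minus_complex.sel one_complex.sel)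
    hence "cmod z ^ r * Re (u z ^ r) \<ge> cmod z ^ r * (1/2)" by (intro mult_left_mono) auto
    ultimately show ?thesis by simp
  qed
  have "cmod z1 ^ r / 2 \<le> Re (z1 ^ r + z2 ^ r + z3 ^ r)"
    using Re[OF r(2)] order.trans[OF _ Re[OF r(3)], of 0] order.trans[OF _ Re[OF r(4)], of 0]
    by simp
  also have "\<dots> \<le> C" using complex_Re_le_cmod[of "z1 ^ r + z2 ^ r + z3 ^ r"] bound[of r] r by simp
  finally have "cmod z1 ^ r \<le> 2 * C" by simp
  moreover have "cmod z1 ^ N \<le> cmod z1 ^ r"
    using \<open>cmod z1 > 1\<close> r by (intro power_increasing) auto
  ultimately show False using N by simp
qed

text \<open>The w_i are the roots of X^3 + A1 X^2 + A2 X + A3, the reversal of 1 + A1 T + A2 T^2 +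
  A3 T^3. Some of them are 0 if the latter has smaller degree.\<close>

lemma cubic_roots:
  fixes A1 A2 A3 :: complex
  shows "\<exists>w1 w2 w3. A1 = -(w1 + w2 + w3) \<and> A2 = w1 * w2 + w1 * w3 + w2 * w3 \<and> A3 = -(w1 * w2 * w3)"
proof -
  let ?p = "[:A3, A2, A1, 1:]"
  obtain A where A: "size A = degree ?p" "?p = smult (lead_coeff ?p) (\<Prod>x\<in>#A. [:-x, 1:])"
    using alg_closed_imp_factorization[of ?p] by auto
  have sA: "size A = Suc (Suc (Suc 0))" using A(1) by simp
  then obtain w1 B where B: "A = add_mset w1 B" using size_eq_Suc_imp_eq_union by blast
  with sA have sB: "size B = Suc (Suc 0)" by simp
  then obtain w2 D where D: "B = add_mset w2 D" using size_eq_Suc_imp_eq_union by blast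
  with sB have "size D = Suc 0" by simp
  then obtain w3 where "D = {#w3#}" using size_1_singleton_mset by fastforce
  hence "A = {#w1, w2, w3#}" by (simp add: B D)
  hence "?p = [:-w1, 1:] * ([:-w2, 1:] * [:-w3, 1:])" using A(2) by simp
  thus ?thesis by (intro exI[of _ w1] exI[of _ w2] exI[of _ w3]) (auto simp: algebra_simps)
qed

section \<open>The Weil bound\<close>

context quartic_sum
begin

text \<open>Since \<open>L_coeff\<close> vanishes from 4 on, Newton's identity becomes a linear
  recurrence for \<open>char_sum\<close> with characteristic roots w1, w2, w3. The identities for k
  = 1, 2, 3 supply the initial values.\<close>

lemma char_sum_eq_power_sums:
  "\<exists>w1 w2 w3. \<forall>m\<ge>1. char_sum m = - (w1 ^ m + w2 ^ m + w3 ^ m)"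
proof -
  define A1 A2 A3 where "A1 = L_coeff 1" and "A2 = L_coeff 2" and "A3 = L_coeff 3"
  obtain w1 w2 w3 where w: "A1 = -(w1 + w2 + w3)" "A2 = w1 * w2 + w1 * w3 + w2 * w3" "A3 = -(w1 * w2 * w3)"
    using cubic_roots[of A1 A2 A3] by blast
  have root: "x ^ 3 = - (A1 * x ^ 2 + A2 * x + A3)" if "x \<in> {w1, w2, w3}" for x
    using that by (auto simp: w algebra_simps eval_nat_numeral)
  have S1: "char_sum 1 = A1"
    using newton_char_sum[of 1] by (simp add: L_coeff_0 A1_def)
  have S2: "2 * A2 = char_sum 1 * A1 + char_sum 2"
    using newton_char_sum[of 2] by (simp add: L_coeff_0 A1_def A2_def eval_nat_numeral)
  have S3: "3 * A3 = char_sum 1 * A2 + char_sum 2 * A1 + char_sum 3"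
    using newton_char_sum[of 3] by (simp add: L_coeff_0 A1_def A2_def A3_def eval_nat_numeral)
  have rec: "char_sum (m + 3) = - (A1 * char_sum (m + 2) + A2 * char_sum (m + 1) + A3 * char_sum m)"
    if "m \<ge> 1" for m
  proof -
    have "0 = (\<Sum>j=1..m+3. char_sum j * L_coeff (m + 3 - j))"
      using newton_char_sum[of "m + 3"] L_coeff_eq_0[of "m + 3"] that by simp
    also have "\<dots> = (\<Sum>j\<in>{m, m+1, m+2, m+3}. char_sum j * L_coeff (m + 3 - j))"
      by (rule sum.mono_neutral_right) (use that in \<open>auto simp: L_coeff_eq_0\<close>)
    also have "\<dots> = A3 * char_sum m + A2 * char_sum (m + 1) + A1 * char_sum (m + 2) + char_sum (m + 3)"
      by (simp add: L_coeff_0 A1_def A2_def A3_def eval_nat_numeral)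
    finally show ?thesis by (simp add: algebra_simps eq_neg_iff_add_eq_0)
  qed
  have "char_sum m = - (w1 ^ m + w2 ^ m + w3 ^ m)" if "m \<ge> 1" for m
    using that
  proof (induction m rule: less_induct)
    case (less m)
    consider "m = 1" | "m = 2" | "m = 3" | k where "m = k + 3" "k \<ge> 1"
    proof -
      assume *: "m = 1 \<Longrightarrow> thesis" "m = 2 \<Longrightarrow> thesis" "m = 3 \<Longrightarrow> thesis" "\<And>k. m = k + 3 \<Longrightarrow> 1 \<le> k \<Longrightarrow> thesis"
      have "m = 1 \<or> m = 2 \<or> m = 3 \<or> (m = (m - 3) + 3 \<and> 1 \<le> m - 3)" using less.prems by arith
      thus thesis using * by blast
    qed
    thus ?case
    proof cases
      case 1
      thus ?thesis using S1 w(1) by simp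
    next
      case 2
      have "char_sum 2 = 2 * A2 - A1 * A1" using S1 S2 by (simp add: algebra_simps)
      thus ?thesis using 2 by (simp add: w power2_eq_square algebra_simps)
    next
      case 3
      have "char_sum 2 = 2 * A2 - A1 * A1" using S1 S2 by (simp add: algebra_simps)
      moreover have "char_sum 3 = 3 * A3 - char_sum 1 * A2 - char_sum 2 * A1" using S3 by (simp add: algebra_simps)
      ultimately have "char_sum 3 = 3 * A3 - A1 * A2 - (2 * A2 - A1 * A1) * A1" using S1 by simp
      thus ?thesis using 3 by (simp add: w power3_eq_cube algebra_simps)
    next
      case (4 k)
      have x: "x ^ (k + 3) = - (A1 * x ^ (k + 2) + A2 * x ^ (k + 1) + A3 * x ^ k)" if "x \<in> {w1, w2, w3}" for x
      proof -
        have "x ^ (k + 3) = x ^ k * x ^ 3" by (simp add: power_add)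
        also have "\<dots> = - (A1 * (x ^ k * x ^ 2) + A2 * (x ^ k * x) + A3 * x ^ k)"
          unfolding root[OF that] by (simp add: algebra_simps)
        finally show ?thesis by (simp add: power_add power2_eq_square)
      qed
      have "char_sum m = - (A1 * char_sum (k + 2) + A2 * char_sum (k + 1) + A3 * char_sum k)"
        unfolding 4(1) by (rule rec) (rule 4(2))
      also have "char_sum (k + 2) = - (w1 ^ (k + 2) + w2 ^ (k + 2) + w3 ^ (k + 2))"
        by (rule less.IH) (use 4 in auto)
      also have "char_sum (k + 1) = - (w1 ^ (k + 1) + w2 ^ (k + 1) + w3 ^ (k + 1))"
        by (rule less.IH) (use 4 in auto)
      also have "char_sum k = - (w1 ^ k + w2 ^ k + w3 ^ k)"
        by (rule less.IH) (use 4 in auto)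
      finally show ?thesis
        unfolding 4(1) x[of w1, simplified] x[of w2, simplified] x[of w3, simplified]
        by (simp add: algebra_simps)
    qed
  qed
  thus ?thesis by blast
qed

theorem weil_bound: "cmod (char_sum 1) \<le> 3 * sqrt (real q)"
proof -
  obtain w1 w2 w3 where w: "\<And>m. m \<ge> 1 \<Longrightarrow> char_sum m = - (w1 ^ m + w2 ^ m + w3 ^ m)"
    using char_sum_eq_power_sums by blast
  define e where "e = degree f * q"
  \<comment> \<open>As q^r > r, every r from here on satisfies the size condition of
    \<open>char_sum_bound\<close>.\<close>
  define r0 where "r0 = e * e + 4 * e + 3"
  define C where "C = 4 * real e + 4"
  define s where "s = complex_of_real (real q)"
  have s: "s \<noteq> 0" "cmod s = real q" by (auto simp: s_def)
  \<comment> \<open>Only even extensions are controlled, so the bounded power sums are those of the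
    normalised squares w_i^2 / q.\<close>
  have "cmod ((w1\<^sup>2 / s) ^ r + (w2\<^sup>2 / s) ^ r + (w3\<^sup>2 / s) ^ r) \<le> C" if "r \<ge> r0" for r
  proof -
    have "r < 2 ^ r" by (rule less_exp)
    also have "\<dots> \<le> q ^ r" using q_ge_2 by (intro power_mono) auto
    finally have large: "q ^ r > e * e + 4 * e + 2" using that by (simp add: r0_def)
    have "r > 0" using that by (simp add: r0_def)
    have "(w1\<^sup>2 / s) ^ r + (w2\<^sup>2 / s) ^ r + (w3\<^sup>2 / s) ^ r = (w1 ^ (2 * r) + w2 ^ (2 * r) + w3 ^ (2 * r)) / s ^ r"
      by (simp add: power_divide add_divide_distrib flip: power_mult)
    also have "\<dots> = - char_sum (2 * r) / s ^ r" using w[of "2 * r"] \<open>r > 0\<close> by simp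
    also have "cmod \<dots> = cmod (char_sum (2 * r)) / real q ^ r"
      by (simp add: norm_divide norm_power s)
    also have "\<dots> \<le> C"
      using char_sum_bound[OF \<open>r > 0\<close>] large by (simp add: e_def C_def divide_le_eq)
    finally show ?thesis .
  qed
  note bound = this
  have "cmod (w1\<^sup>2 / s) \<le> 1"
    by (rule bounded_power_sums_imp_norm_le_1[OF bound])
  moreover have "cmod (w2\<^sup>2 / s) \<le> 1"
    by (rule bounded_power_sums_imp_norm_le_1[of r0 _ "w1\<^sup>2 / s" "w3\<^sup>2 / s" C]) (use bound in \<open>simp add: add_ac\<close>)
  moreover have "cmod (w3\<^sup>2 / s) \<le> 1"
    by (rule bounded_power_sums_imp_norm_le_1[of r0 _ "w1\<^sup>2 / s" "w2\<^sup>2 / s" C]) (use bound in \<open>simp add: add_ac\<close>)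
  moreover have "cmod w \<le> sqrt (real q)" if "cmod (w\<^sup>2 / s) \<le> 1" for w
  proof (rule real_le_rsqrt)
    show "(cmod w)\<^sup>2 \<le> real q"
      using that s by (simp add: norm_divide norm_power divide_le_eq)
  qed
  ultimately have "cmod w1 \<le> sqrt (real q)" "cmod w2 \<le> sqrt (real q)" "cmod w3 \<le> sqrt (real q)"
    by blast+
  moreover have "cmod (char_sum 1) = cmod (w1 + w2 + w3)" 
    using norm_minus_cancel[of "w1 + w2 + w3"] w[of 1] by simp
  moreover have "cmod (w1 + w2 + w3) \<le> cmod w1 + cmod w2 + cmod w3"
    by (meson add_mono norm_triangle_ineq order.refl order.trans)
  ultimately show ?thesis by linarith
qed

end

section \<open>The sequences\<close>

locale sequence_family =
  fixes p n N d :: nat and \<alpha> \<beta> :: "'a::{field, finite}"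
  assumes prime_p: "prime p" and odd_p: "odd p" and p_mod_4: "[p = 3] (mod 4)"
    and odd_n: "odd n"
    and card_UNIV: "card (UNIV :: 'a set) = p ^ n"
    and N_eq: "N = (p ^ n - 1) div 2"
    and d_eq: "d = N + 1"
    and primitive: "primitive_element \<alpha>"
    and \<beta>_nonzero: "\<beta> \<noteq> 0"
begin

section \<open>Arithmetic of q and N, and the powers of the primitive element\<close>

lemma n_pos: "n > 0"
  using odd_n by (rule odd_pos)

lemma q_mod_4: "p ^ n mod 4 = 3"
proof -
  obtain m where m: "n = 2 * m + 1" using odd_n by (rule oddE)
  have "[p ^ n = 3 ^ n] (mod 4)" using p_mod_4 by (rule cong_pow)
  also have "(3::nat) ^ n = 9 ^ m * 3" by (simp add: m power_mult)
  also have "[9 ^ m * 3 = 1 ^ m * (3::nat)] (mod 4)"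
    by (intro cong_mult cong_pow cong_refl) (simp add: unique_euclidean_semiring_class.cong_def)
  finally show ?thesis by (simp add: unique_euclidean_semiring_class.cong_def)
qed

text \<open>Oddness of N is what the residue of q modulo 4 is for: it makes doubling a permutation
  modulo N (\<open>half_sum_eq\<close>) and d = N + 1 even
  (\<open>coefficients_nonzero\<close>).\<close>

lemma q_eq: "p ^ n = 2 * N + 1" and odd_N: "odd N"
proof -
  define Q where "Q = p ^ n"
  have "Q mod 4 = 3" using q_mod_4 by (simp add: Q_def)
  moreover have "N = (Q - 1) div 2" by (simp add: Q_def N_eq)
  ultimately have "Q = 2 * N + 1 \<and> odd N" by presburger
  thus "p ^ n = 2 * N + 1" "odd N" by (simp_all add: Q_def)
qed

lemma N_pos: "N > 0"
  using odd_N by (rule odd_pos)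

lemma half_period_eq: "half_period p n = N"
  by (simp add: half_period_def N_eq)

lemma even_d: "even d"
  using odd_N by (simp add: d_eq)

lemma \<alpha>_nonzero: "\<alpha> \<noteq> 0"
proof -
  have "\<alpha> ^ 1 \<in> range (\<lambda>k. \<alpha> ^ k)" by blast
  thus ?thesis using primitive by (auto simp: primitive_element_def)
qed

lemma \<alpha>_power_eq_1_iff: "\<alpha> ^ k = 1 \<longleftrightarrow> 2 * N dvd k"
  and bij_\<alpha>_powers: "bij_betw (\<lambda>k. \<alpha> ^ k) {..<2 * N} (UNIV - {0})"
proof -
  have "\<not> inj (\<lambda>k::nat. \<alpha> ^ k)"
    using finite_imageD[of "\<lambda>k::nat. \<alpha> ^ k" UNIV] infinite_UNIV_nat by auto
  then obtain i j where "i < j" "\<alpha> ^ i = \<alpha> ^ j"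
    unfolding inj_def by (metis nat_neq_iff)
  moreover have "\<alpha> ^ j = \<alpha> ^ i * \<alpha> ^ (j - i)" using \<open>i < j\<close> by (simp flip: power_add)
  ultimately have ex: "\<exists>e>0. \<alpha> ^ e = 1" using \<alpha>_nonzero by (intro exI[of _ "j - i"]) auto
  define e where "e = (LEAST e. e > 0 \<and> \<alpha> ^ e = 1)"
  have e: "e > 0" "\<alpha> ^ e = 1" using LeastI_ex[OF ex] by (simp_all add: e_def)
  have least: "e \<le> k" if "k > 0" "\<alpha> ^ k = 1" for k
    unfolding e_def using that by (intro Least_le) auto
  have mod: "\<alpha> ^ k = \<alpha> ^ (k mod e)" for k
  proof -
    have "\<alpha> ^ k = \<alpha> ^ (e * (k div e) + k mod e)" by simp
    also have "\<dots> = (\<alpha> ^ e) ^ (k div e) * \<alpha> ^ (k mod e)" by (simp only: power_add power_mult)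
    finally show ?thesis using e by simp
  qed
  have inj: "inj_on (\<lambda>k. \<alpha> ^ k) {..<e}"
  proof (rule linorder_inj_onI)
    fix i j assume ij: "i < j" "i \<in> {..<e}" "j \<in> {..<e}"
    show "\<alpha> ^ i \<noteq> \<alpha> ^ j"
    proof
      assume "\<alpha> ^ i = \<alpha> ^ j"
      moreover have "\<alpha> ^ j = \<alpha> ^ i * \<alpha> ^ (j - i)" using ij by (simp flip: power_add)
      ultimately have "\<alpha> ^ (j - i) = 1" using \<alpha>_nonzero by auto
      thus False using least[of "j - i"] ij by auto
    qed
  qed auto
  have image: "(\<lambda>k. \<alpha> ^ k) ` {..<e} = UNIV - {0}"
  proof -
    have "range (\<lambda>k. \<alpha> ^ k) \<subseteq> (\<lambda>k. \<alpha> ^ k) ` {..<e}"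
    proof
      fix x assume "x \<in> range (\<lambda>k. \<alpha> ^ k)"
      then obtain k where "x = \<alpha> ^ (k mod e)" using mod by blast
      thus "x \<in> (\<lambda>k. \<alpha> ^ k) ` {..<e}" using e(1) by auto
    qed
    hence "(\<lambda>k. \<alpha> ^ k) ` {..<e} = range (\<lambda>k. \<alpha> ^ k)" by blast
    thus ?thesis using primitive by (simp add: primitive_element_def)
  qed
  have "e = card (UNIV - {0 :: 'a})" using card_image[OF inj] image by simp
  hence e_eq: "e = 2 * N" using card_UNIV q_eq by simp
  show "bij_betw (\<lambda>k. \<alpha> ^ k) {..<2 * N} (UNIV - {0})"
    using inj image by (simp add: bij_betw_def e_eq)
  show "\<alpha> ^ k = 1 \<longleftrightarrow> 2 * N dvd k"
  proof
    assume "\<alpha> ^ k = 1"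
    hence "\<alpha> ^ (k mod e) = 1" using mod by simp
    hence "k mod e = 0" using least[of "k mod e"] e(1) mod_less_divisor[of e k] by linarith
    thus "2 * N dvd k" by (simp add: e_eq dvd_eq_mod_eq_0)
  next
    assume "2 * N dvd k"
    thus "\<alpha> ^ k = 1" using e by (auto simp: e_eq power_mult)
  qed
qed

lemma \<alpha>_power_eq_iff: "\<alpha> ^ j = \<alpha> ^ k \<longleftrightarrow> [j = k] (mod 2 * N)"
proof -
  have *: "\<alpha> ^ j = \<alpha> ^ k \<longleftrightarrow> [j = k] (mod 2 * N)" if "j \<le> k" for j k
  proof -
    have "\<alpha> ^ k = \<alpha> ^ j * \<alpha> ^ (k - j)" using that by (simp flip: power_add)
    hence "\<alpha> ^ j = \<alpha> ^ k \<longleftrightarrow> \<alpha> ^ (k - j) = 1" using \<alpha>_nonzero by auto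
    also have "\<dots> \<longleftrightarrow> [k = j] (mod 2 * N)"
      using that by (simp add: \<alpha>_power_eq_1_iff cong_altdef_nat)
    finally show ?thesis by (simp add: cong_sym_eq)
  qed
  show ?thesis using *[of j k] *[of k j] by (cases "j \<le> k") (auto simp: cong_sym_eq eq_commute)
qed

lemma power_q: "x ^ p ^ n = x" for x :: 'a
proof (cases "x = 0")
  case False
  then obtain k where "x = \<alpha> ^ k" using primitive by (auto simp: primitive_element_def)
  moreover have "\<alpha> ^ (k * p ^ n) = \<alpha> ^ (2 * N * k) * \<alpha> ^ k"
    by (simp add: q_eq algebra_simps flip: power_add)
  moreover have "\<alpha> ^ (2 * N * k) = 1" unfolding \<alpha>_power_eq_1_iff by simp
  ultimately show ?thesis by (simp add: power_mult)
qed (use prime_gt_0_nat[OF prime_p] in auto)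

section \<open>The absolute trace and the canonical additive character\<close>

lemma CHAR_eq: "CHAR('a) = p"
proof -
  have "CHAR('a) > 0" by (rule finite_imp_CHAR_pos) simp
  hence "prime CHAR('a)" by (rule prime_CHAR_semidom)
  moreover have "CHAR('a) dvd p ^ n" using CHAR_dvd_CARD[where 'a = 'a] card_UNIV by simp
  ultimately show ?thesis using prime_p by (metis prime_dvd_power_iff primes_dvd_imp_eq n_pos prime_dvd_power)
qed

lemma power_p_add: "(x + y :: 'a) ^ p ^ k = x ^ p ^ k + y ^ p ^ k"
  by (rule freshmans_dream'[of "p ^ k" k]) (simp_all add: CHAR_eq prime_p)

lemma Tr_add: "Tr p n (x + y :: 'a) = Tr p n x + Tr p n y"
  by (simp add: Tr_def power_p_add sum.distrib)

lemma Tr_diff: "Tr p n (x - y :: 'a) = Tr p n x - Tr p n y"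
  using Tr_add[of "x - y" y] by simp

lemma Tr_0 [simp]: "Tr p n (0 :: 'a) = 0"
  using Tr_diff[of 0 0] by simp

text \<open>X^p - X has at most p roots, and the p images of 0, ..., p - 1 are already
  roots.\<close>

lemma prime_field: "x ^ p = (x :: 'a) \<Longrightarrow> x \<in> range of_nat"
proof -
  assume x: "x ^ p = x"
  let ?P = "monom 1 p - [:0, 1:] :: 'a poly"
  have p: "p > 1" using prime_p by (rule prime_gt_1_nat)
  have deg: "degree ?P = p"
  proof -
    have "degree (monom (1::'a) p + - [:0, 1:]) = degree (monom (1::'a) p)"
      by (rule degree_add_eq_left) (use p in \<open>auto simp: degree_monom_eq\<close>)
    thus ?thesis by (simp only: add_uminus_conv_diff degree_monom_eq) (simp add: degree_monom_eq)
  qed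
  have "?P \<noteq> 0" using deg p degree_0 not_less0 by metis
  have roots: "{y. poly ?P y = 0} = {y. y ^ p = y}" by (auto simp: poly_monom)
  have "of_nat ` {..<p} \<subseteq> {y::'a. y ^ p = y}"
  proof safe
    fix k
    show "of_nat k ^ p = (of_nat k :: 'a)"
      using power_p_add[of _ _ 1] p by (induction k) auto
  qed
  moreover have "card {y::'a. y ^ p = y} \<le> card (of_nat ` {..<p} :: 'a set)"
  proof -
    have "inj_on (of_nat :: nat \<Rightarrow> 'a) {..<p}"
      by (auto simp: inj_on_def of_nat_eq_iff_cong_CHAR CHAR_eq unique_euclidean_semiring_class.cong_def)
    hence "card (of_nat ` {..<p} :: 'a set) = p" by (simp add: card_image)
    thus ?thesis using card_poly_roots_bound[OF \<open>?P \<noteq> 0\<close>] deg roots by simp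
  qed
  ultimately have "of_nat ` {..<p} = {y::'a. y ^ p = y}" by (intro card_seteq) auto
  thus ?thesis using x by auto
qed

lemma Tr_range: "Tr p n (x::'a) \<in> range of_nat"
proof (rule prime_field)
  have "Tr p n x ^ p = (\<Sum>k<n. (x ^ p ^ k) ^ p)"
    unfolding Tr_def by (rule freshmans_dream_sum'[of p 1]) (simp_all add: CHAR_eq prime_p)
  also have "\<dots> = (\<Sum>k<n. x ^ p ^ Suc k)"
    by (simp add: mult.commute flip: power_mult)
  also have "\<dots> + x = (\<Sum>k<Suc n. x ^ p ^ k)"
    by (subst sum.lessThan_Suc_shift) simp
  also have "\<dots> = Tr p n x + x" by (simp add: Tr_def power_q)
  finally show "Tr p n x ^ p = Tr p n x" by simp
qed

lemma omega_power_eq_1_iff: "omega p ^ k = 1 \<longleftrightarrow> p dvd k"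
proof -
  have "omega p ^ k = exp (2 * of_real pi * \<i> * of_nat k / of_nat p)"
    by (simp add: omega_def mult_ac flip: exp_of_nat_mult)
  thus ?thesis using complex_root_unity_eq_1[of p k] prime_gt_0_nat[OF prime_p] by simp
qed

lemma omega_pow_of_nat: "omega_pow p (of_nat k :: 'a) = omega p ^ k"
proof -
  have p: "p > 0" using prime_p by (rule prime_gt_0_nat)
  have "(THE j. j < p \<and> of_nat j = (of_nat k :: 'a)) = k mod p"
    using p by (intro the_equality)
      (auto simp: of_nat_eq_iff_cong_CHAR CHAR_eq unique_euclidean_semiring_class.cong_def)
  moreover have "omega p ^ k = omega p ^ (k mod p)"
  proof -
    have "omega p ^ k = omega p ^ (p * (k div p) + k mod p)" by simp
    also have "\<dots> = (omega p ^ p) ^ (k div p) * omega p ^ (k mod p)" by (simp only: power_add power_mult)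
    finally show ?thesis using omega_power_eq_1_iff[of p] by simp
  qed
  ultimately show ?thesis by (simp add: omega_pow_def)
qed

definition \<psi> :: "'a \<Rightarrow> complex" where
  "\<psi> x = omega_pow p (Tr p n x)"

lemma \<psi>_add: "\<psi> (x + y) = \<psi> x * \<psi> y"
proof -
  obtain j k where jk: "Tr p n x = of_nat j" "Tr p n y = of_nat k" using Tr_range by blast
  have "\<psi> (x + y) = omega_pow p (of_nat (j + k) :: 'a)" by (simp add: \<psi>_def Tr_add jk)
  also have "\<dots> = \<psi> x * \<psi> y" unfolding omega_pow_of_nat by (simp add: \<psi>_def jk omega_pow_of_nat power_add)
  finally show ?thesis .
qed

lemma \<psi>_0: "\<psi> 0 = 1"
  using omega_pow_of_nat[of 0] by (simp add: \<psi>_def)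

lemma norm_\<psi>: "cmod (\<psi> x) = 1"
proof -
  obtain j where "Tr p n x = of_nat j" using Tr_range by blast
  moreover have "cmod (omega p) = 1"
    unfolding omega_def by (simp add: norm_exp_i_times norm_exp_eq_Re)
  ultimately show ?thesis by (simp add: \<psi>_def omega_pow_of_nat norm_power)
qed

text \<open>Otherwise the trace would vanish on all q elements, although it is given by a polynomial
  of degree at most p^(n-1) < q, nonzero because X has coefficient 1.\<close>

lemma \<psi>_nontrivial: "\<exists>x. \<psi> x \<noteq> 1"
proof (rule ccontr)
  assume *: "\<nexists>x. \<psi> x \<noteq> 1"
  have Tr0: "Tr p n x = 0" for x :: 'a
  proof -
    obtain k where k: "Tr p n x = of_nat k" using Tr_range by blast
    have "omega p ^ k = 1" using * by (metis k omega_pow_of_nat \<psi>_def)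
    thus ?thesis using k by (simp add: omega_power_eq_1_iff of_nat_eq_0_iff_char_dvd CHAR_eq)
  qed
  define P :: "'a poly" where "P = (\<Sum>k<n. monom 1 (p ^ k))"
  have inj: "p ^ k = p ^ 0 \<longleftrightarrow> k = 0" for k
    using prime_gt_1_nat[OF prime_p] by (intro power_inject_exp)
  have "coeff P (p ^ 0) = (\<Sum>k<n. if k = 0 then 1 else 0)"
    unfolding P_def coeff_sum coeff_monom inj ..
  also have "\<dots> = 1" using n_pos by simp
  finally have "P \<noteq> 0" by auto
  have "{x. poly P x = 0} = UNIV"
    using Tr0 by (auto simp: P_def poly_sum poly_monom Tr_def)
  hence "p ^ n \<le> degree P" using card_poly_roots_bound[OF \<open>P \<noteq> 0\<close>] card_UNIV by simp
  also have "degree P \<le> p ^ (n - 1)" unfolding P_def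
    using prime_gt_1_nat[OF prime_p]
    by (intro degree_sum_le) (auto intro!: order.trans[OF degree_monom_le] power_increasing)
  also have "\<dots> < p ^ n" using n_pos prime_gt_1_nat[OF prime_p] by (intro power_strict_increasing) auto
  finally show False by simp
qed

text \<open>The Weil bound is applied in \<open>'a alg_closure\<close>, where \<open>Fix 1\<close>
  is the image of F_q: it contains the image and has the same number of elements. The polynomial has
  degree 4 or 2, which is prime to the odd number q, and for m = 1 the relative trace is the
  identity.\<close>

lemma quartic_sum_bound:
  assumes "A \<noteq> 0 \<or> B \<noteq> 0"
  shows "cmod (\<Sum>y\<in>UNIV. \<psi> (A * y ^ 4 + B * y ^ 2)) \<le> 3 * sqrt (real (p ^ n))"
proof -
  let ?f = "[:0, 0, to_ac B, 0, to_ac A:]"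
  have pK: "CHAR('a alg_closure) = p" by (simp add: CHAR_eq)
  have deg: "degree ?f = (if A = 0 then 2 else 4)" using assms by simp
  have "coprime 2 p" using odd_p by simp
  hence cop: "coprime 2 (p ^ n)" "coprime 4 (p ^ n)"
    using coprime_power_left_iff[of 2 2 "p ^ n"] by simp_all
  have to_ac_power: "to_ac x ^ p ^ n = to_ac x" for x :: 'a
    using power_q[of x] by (metis to_ac_power)
  interpret artin_schreier "p ^ n" n ?f
  proof
    show "coeff ?f i ^ p ^ n = coeff ?f i" for i
      using to_ac_power prime_gt_0_nat[OF prime_p] by (auto simp: coeff_pCons split: nat.splits)
    show "degree ?f > 0" "coprime (degree ?f) (p ^ n)" unfolding deg using cop by auto
  qed (use prime_p n_pos in \<open>simp_all add: CHAR_eq\<close>)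
  have Fix_eq: "Fix 1 = range to_ac"
  proof (rule card_seteq[symmetric])
    show "finite (Fix 1)" by (rule finite_Fix) simp
    show "range to_ac \<subseteq> Fix 1" unfolding Fix_def using to_ac_power by auto
    show "card (Fix 1) \<le> card (range (to_ac :: 'a \<Rightarrow> _))"
      using card_Fix[of 1] card_UNIV by (simp add: card_image inj_to_ac)
  qed
  interpret quartic_sum "p ^ n" n ?f "\<lambda>x. \<psi> (of_ac x)" "to_ac A" "to_ac B"
  proof
    show "\<exists>x\<in>Fix 1. \<psi> (of_ac x) \<noteq> 1"
      unfolding Fix_eq using \<psi>_nontrivial by simp
    show "(2 :: 'a alg_closure) \<noteq> 0"
    proof
      assume "(2 :: 'a alg_closure) = 0"
      hence "of_nat 2 = (0 :: 'a alg_closure)" by simp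
      hence "p dvd 2" by (simp only: of_nat_eq_0_iff_char_dvd pK)
      thus False using odd_p prime_p by (metis dvd_refl primes_dvd_imp_eq two_is_prime_nat)
    qed
    show "\<psi> (of_ac (x + y)) = \<psi> (of_ac x) * \<psi> (of_ac y)" if "x \<in> Fix 1" "y \<in> Fix 1" for x y
      using that unfolding Fix_eq by (auto simp: \<psi>_add simp flip: to_ac_add)
  qed (simp_all add: norm_\<psi>)
  have "char_sum 1 = (\<Sum>x\<in>UNIV. \<psi> (of_ac (trace 1 (poly ?f (to_ac x)))))"
    unfolding char_sum_def Fix_eq by (simp add: sum.reindex inj_to_ac)
  also have "\<dots> = (\<Sum>y\<in>UNIV. \<psi> (A * y ^ 4 + B * y ^ 2))"
  proof (rule sum.cong[OF refl])
    fix y :: 'a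
    have "trace 1 (poly ?f (to_ac y)) = to_ac (A * y ^ 4 + B * y ^ 2)"
      by (simp only: trace_def poly_f) simp
    thus "\<psi> (of_ac (trace 1 (poly ?f (to_ac y)))) = \<psi> (A * y ^ 4 + B * y ^ 2)" by (simp only: of_ac_to_ac)
  qed
  finally show ?thesis using weil_bound by simp
qed

text \<open>
  Substituting \<open>t = 2 * k mod N\<close> turns the exponents \<open>2 * t\<close> and \<open>(N + 1) * t\<close> into \<open>4 * k\<close> and
  \<open>2 * k\<close> (as \<open>N\<close> is odd), so the sum over all \<open>y = \<alpha>^k\<close> runs through the values of \<open>t\<close> twice.
\<close>

lemma half_sum_eq:
  "2 * (\<Sum>t<N. \<psi> (A * \<alpha> ^ (2 * t) + B * \<alpha> ^ ((N + 1) * t))) + 1 = (\<Sum>y\<in>UNIV. \<psi> (A * y ^ 4 + B * y ^ 2))"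
proof -
  define g where "g t = \<psi> (A * \<alpha> ^ (2 * t) + B * \<alpha> ^ ((N + 1) * t))" for t
  \<comment> \<open>As N + 1 is even, increasing t by N does not change the second exponent modulo 2
    * N; hence \<open>g\<close> has period N.\<close>
  have dvd: "2 * N dvd (N + 1) * N" using odd_N by (intro mult_dvd_mono) auto
  have per: "g (t + N * k) = g t" for t k
  proof -
    have "\<alpha> ^ (2 * (t + N * k)) = \<alpha> ^ (2 * t) * \<alpha> ^ (2 * N * k)"
      by (simp add: algebra_simps flip: power_add)
    also have "\<alpha> ^ (2 * N * k) = 1" unfolding \<alpha>_power_eq_1_iff by simp
    finally have 1: "\<alpha> ^ (2 * (t + N * k)) = \<alpha> ^ (2 * t)" by simp
    have "\<alpha> ^ ((N + 1) * (t + N * k)) = \<alpha> ^ ((N + 1) * t) * \<alpha> ^ ((N + 1) * N * k)"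
      by (simp add: algebra_simps flip: power_add)
    also have "\<alpha> ^ ((N + 1) * N * k) = 1" unfolding \<alpha>_power_eq_1_iff using dvd by (rule dvd_mult2)
    finally have 2: "\<alpha> ^ ((N + 1) * (t + N * k)) = \<alpha> ^ ((N + 1) * t)" by simp
    show ?thesis unfolding g_def 1 2 ..
  qed
  have g2: "\<psi> (A * (\<alpha> ^ k) ^ 4 + B * (\<alpha> ^ k) ^ 2) = g (2 * k)" for k
  proof -
    have "\<alpha> ^ ((N + 1) * (2 * k)) = \<alpha> ^ (2 * N * k) * \<alpha> ^ (2 * k)"
      by (simp add: algebra_simps flip: power_add)
    also have "\<alpha> ^ (2 * N * k) = 1" unfolding \<alpha>_power_eq_1_iff by simp
    finally show ?thesis by (simp add: g_def mult.commute flip: power_mult)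
  qed
  have bij: "bij_betw (\<lambda>k. 2 * k mod N) {..<N} {..<N}"
  proof -
    have "inj_on (\<lambda>k. 2 * k mod N) {..<N}"
    proof (rule inj_onI)
      fix i j assume ij: "i \<in> {..<N}" "j \<in> {..<N}" and "2 * i mod N = 2 * j mod N"
      hence "[2 * i = 2 * j] (mod N)" by (simp add: unique_euclidean_semiring_class.cong_def)
      hence "[i = j] (mod N)" using odd_N by (subst (asm) cong_mult_lcancel_nat) auto
      thus "i = j" using ij by (simp add: unique_euclidean_semiring_class.cong_def)
    qed
    moreover have "(\<lambda>k. 2 * k mod N) ` {..<N} \<subseteq> {..<N}" using N_pos by auto
    ultimately show ?thesis
      by (simp add: bij_betw_def endo_inj_surj)
  qed
  have "(\<Sum>k<N. g (2 * k)) = (\<Sum>k<N. g (2 * k mod N))"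
    using per[of "2 * _ mod N" "2 * _ div N"] by (intro sum.cong refl) (metis mod_mult_div_eq)
  also have "\<dots> = (\<Sum>t<N. g t)" by (rule sum.reindex_bij_betw[OF bij])
  finally have half: "(\<Sum>k<N. g (2 * k)) = (\<Sum>t<N. g t)" .
  have "(\<Sum>y\<in>UNIV - {0}. \<psi> (A * y ^ 4 + B * y ^ 2)) = (\<Sum>k<2 * N. g (2 * k))"
    by (subst sum.reindex_bij_betw[OF bij_\<alpha>_powers, symmetric]) (simp add: g2)
  also have "\<dots> = (\<Sum>k<N. g (2 * k)) + (\<Sum>k<N. g (2 * (N + k)))"
  proof -
    have "{..<2 * N} = {..<N} \<union> {N..<2 * N}" by auto
    hence "(\<Sum>k<2 * N. g (2 * k)) = (\<Sum>k<N. g (2 * k)) + (\<Sum>k=N..<2 * N. g (2 * k))"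
      by (simp add: sum.union_disjoint ivl_disj_int)
    also have "(\<Sum>k=N..<2 * N. g (2 * k)) = (\<Sum>k<N. g (2 * (N + k)))"
      using sum.shift_bounds_nat_ivl[of "\<lambda>k. g (2 * k)" 0 N N]
      by (simp add: mult_2 add.commute atLeast0LessThan)
    finally show ?thesis .
  qed
  also have "(\<Sum>k<N. g (2 * (N + k))) = (\<Sum>k<N. g (2 * k))"
    using per[of "2 * _" 2] by (intro sum.cong refl) (simp add: algebra_simps)
  also have "(\<Sum>k<N. g (2 * k)) + (\<Sum>k<N. g (2 * k)) = 2 * (\<Sum>t<N. g t)" by (simp add: half)
  finally have "(\<Sum>y\<in>UNIV - {0}. \<psi> (A * y ^ 4 + B * y ^ 2)) = 2 * (\<Sum>t<N. g t)" .
  \<comment> \<open>The point y = 0, which is no power of \<alpha>, accounts for the summand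
    1.\<close>
  moreover have "(\<Sum>y\<in>UNIV. \<psi> (A * y ^ 4 + B * y ^ 2)) =
      \<psi> (A * 0 ^ 4 + B * 0 ^ 2) + (\<Sum>y\<in>UNIV - {0}. \<psi> (A * y ^ 4 + B * y ^ 2))"
    by (rule sum.remove) auto
  ultimately show ?thesis by (simp add: \<psi>_0 g_def)
qed

text \<open>The constants come from |C| \<le> (3 sqrt q + 1) / 2 with q = 2 (N + 1/2): half of 3
  sqrt 2 is 3 / sqrt 2.\<close>

lemma half_sum_bound:
  assumes "A \<noteq> 0 \<or> B \<noteq> 0"
  shows "cmod (\<Sum>t<N. \<psi> (A * \<alpha> ^ (2 * t) + B * \<alpha> ^ ((N + 1) * t))) \<le> 3 / sqrt 2 * sqrt (real N + 1 / 2) + 1 / 2"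
proof -
  define C where "C = (\<Sum>t<N. \<psi> (A * \<alpha> ^ (2 * t) + B * \<alpha> ^ ((N + 1) * t)))"
  have "2 * cmod C = cmod ((2 * C + 1) - 1)" by (simp add: norm_mult)
  also have "\<dots> \<le> cmod (2 * C + 1) + 1" using norm_triangle_ineq4[of "2 * C + 1" 1] by simp
  also have "cmod (2 * C + 1) \<le> 3 * sqrt (real (p ^ n))"
    unfolding C_def half_sum_eq by (rule quartic_sum_bound[OF assms])
  also have "real (p ^ n) = 2 * (real N + 1 / 2)" by (simp only: q_eq) simp
  also have "sqrt \<dots> = sqrt 2 * sqrt (real N + 1 / 2)" by (rule real_sqrt_mult)
  also have "sqrt 2 = 2 / sqrt 2" by (simp add: real_div_sqrt)
  finally show ?thesis unfolding C_def by simp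
qed

section \<open>Correlations of the family and their maximum\<close>

lemma correlation_eq:
  "correlation p N (\<lambda>t. m_seq p n \<beta> \<alpha> (2 * t + i1) + m_seq p n \<beta> \<alpha> (d * (t + l1) + j1))
     (\<lambda>t. m_seq p n \<beta> \<alpha> (2 * t + i2) + m_seq p n \<beta> \<alpha> (d * (t + l2) + j2)) \<tau> =
   (\<Sum>t<N. \<psi> (\<beta> * (\<alpha> ^ i1 - \<alpha> ^ (2 * \<tau> + i2)) * \<alpha> ^ (2 * t) +
     \<beta> * (\<alpha> ^ (d * l1 + j1) - \<alpha> ^ (d * \<tau> + d * l2 + j2)) * \<alpha> ^ ((N + 1) * t)))"
  unfolding correlation_def
proof (rule sum.cong[OF refl])
  fix t
  have "\<beta> * (\<alpha> ^ i1 - \<alpha> ^ (2 * \<tau> + i2)) * \<alpha> ^ (2 * t) +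
     \<beta> * (\<alpha> ^ (d * l1 + j1) - \<alpha> ^ (d * \<tau> + d * l2 + j2)) * \<alpha> ^ ((N + 1) * t) =
     (\<beta> * \<alpha> ^ (2 * t + i1) + \<beta> * \<alpha> ^ (d * (t + l1) + j1)) -
     (\<beta> * \<alpha> ^ (2 * (t + \<tau>) + i2) + \<beta> * \<alpha> ^ (d * (t + \<tau> + l2) + j2))"
    unfolding d_eq[symmetric] by (simp add: power_add algebra_simps)
  thus "omega_pow p (m_seq p n \<beta> \<alpha> (2 * t + i1) + m_seq p n \<beta> \<alpha> (d * (t + l1) + j1) -
      (m_seq p n \<beta> \<alpha> (2 * (t + \<tau>) + i2) + m_seq p n \<beta> \<alpha> (d * (t + \<tau> + l2) + j2))) =
    \<psi> (\<beta> * (\<alpha> ^ i1 - \<alpha> ^ (2 * \<tau> + i2)) * \<alpha> ^ (2 * t) +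
     \<beta> * (\<alpha> ^ (d * l1 + j1) - \<alpha> ^ (d * \<tau> + d * l2 + j2)) * \<alpha> ^ ((N + 1) * t))"
    by (simp only: m_seq_def \<psi>_def Tr_add Tr_diff)
qed

text \<open>If both coefficients vanish, the exponents of \<alpha> agree modulo 2 * N. Since 2 and d
  are even, parity yields i1 = i2 and j1 = j2. The first congruence then forces \<tau> = 0, and as d
  = N + 1 is prime to N, the second one gives l1 = l2.\<close>

lemma coefficients_nonzero:
  assumes "i1 \<le> 1" "i2 \<le> 1" "j1 \<le> 1" "j2 \<le> 1" "l1 < N" "l2 < N" "\<tau> < N"
    and nontrivial: "\<not> (\<tau> = 0 \<and> i1 = i2 \<and> j1 = j2 \<and> l1 = l2)"
  shows "\<beta> * (\<alpha> ^ i1 - \<alpha> ^ (2 * \<tau> + i2)) \<noteq> 0 \<or>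
    \<beta> * (\<alpha> ^ (d * l1 + j1) - \<alpha> ^ (d * \<tau> + d * l2 + j2)) \<noteq> 0"
proof (rule ccontr)
  assume "\<not> ?thesis"
  hence eq: "[i1 = 2 * \<tau> + i2] (mod 2 * N)" "[d * l1 + j1 = d * \<tau> + d * l2 + j2] (mod 2 * N)"
    using \<beta>_nonzero by (auto simp flip: \<alpha>_power_eq_iff)
  have parity: "i = j" if "[i + 2 * x = j + 2 * y] (mod 2 * N)" "i \<le> 1" "j \<le> 1" for i j x y :: nat
  proof -
    have "[i + 2 * x = j + 2 * y] (mod 2)" using that(1) by (rule cong_dvd_modulus_nat) simp
    hence "i mod 2 = j mod 2" by (simp add: unique_euclidean_semiring_class.cong_def)
    thus ?thesis using that by simp
  qed
  obtain d' where d': "d = 2 * d'" using even_d by blast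
  have i: "i1 = i2" using parity[of i1 0 i2 \<tau>] eq(1) assms by (simp add: add.commute)
  have "[0 = 2 * \<tau>] (mod 2 * N)" using eq(1) unfolding i by (metis add_0 cong_add_rcancel_nat)
  hence \<tau>: "\<tau> = 0" using assms(7) by (simp add: unique_euclidean_semiring_class.cong_def)
  have j: "j1 = j2"
    using parity[of j1 "d' * l1" j2 "d' * l2"] eq(2) assms by (simp add: \<tau> d' add.commute mult.assoc)
  have "[d * l1 = d * l2] (mod 2 * N)" using eq(2) by (simp add: \<tau> j cong_add_rcancel_nat)
  hence "[d * l1 = d * l2] (mod N)" by (rule cong_dvd_modulus_nat) simp
  hence "[l1 = l2] (mod N)"
    by (subst (asm) cong_mult_lcancel_nat) (simp_all add: d_eq)
  hence "l1 = l2" using assms by (simp add: unique_euclidean_semiring_class.cong_def)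
  thus False using nontrivial i j \<tau> by simp
qed

lemma C_max_le: "C_max p n \<beta> \<alpha> \<le> 3 / sqrt 2 * sqrt (real N + 1 / 2) + 1 / 2"
proof -
  define F where "F i1 i2 j1 j2 l1 l2 \<tau> =
    cmod (correlation p N (S_seq p n \<beta> \<alpha> i1 j1 l1) (S_seq p n \<beta> \<alpha> i2 j2 l2) \<tau>)" for i1 i2 j1 j2 l1 l2 \<tau>
  define V where "V = {F i1 i2 j1 j2 l1 l2 \<tau> | i1 i2 j1 j2 l1 l2 \<tau>.
      i1 \<le> 1 \<and> i2 \<le> 1 \<and> j1 \<le> 1 \<and> j2 \<le> 1 \<and> l1 < N \<and> l2 < N \<and> \<tau> < N \<and>
      \<not> (\<tau> = 0 \<and> i1 = i2 \<and> j1 = j2 \<and> l1 = l2)}"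
  have "C_max p n \<beta> \<alpha> = Max V"
    unfolding C_max_def V_def F_def half_period_eq ..
  also have "\<dots> \<le> 3 / sqrt 2 * sqrt (real N + 1 / 2) + 1 / 2"
  proof (rule Max.boundedI)
    have "V \<subseteq> (\<lambda>(i1, i2, j1, j2, l1, l2, \<tau>). F i1 i2 j1 j2 l1 l2 \<tau>) `
        ({..1} \<times> {..1} \<times> {..1} \<times> {..1} \<times> {..<N} \<times> {..<N} \<times> {..<N})"
    proof
      fix x assume "x \<in> V"
      then obtain i1 i2 j1 j2 l1 l2 \<tau> where "x = F i1 i2 j1 j2 l1 l2 \<tau>"
        "i1 \<le> 1" "i2 \<le> 1" "j1 \<le> 1" "j2 \<le> 1" "l1 < N" "l2 < N" "\<tau> < N"
        unfolding V_def by blast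
      thus "x \<in> (\<lambda>(i1, i2, j1, j2, l1, l2, \<tau>). F i1 i2 j1 j2 l1 l2 \<tau>) `
          ({..1} \<times> {..1} \<times> {..1} \<times> {..1} \<times> {..<N} \<times> {..<N} \<times> {..<N})"
        by (intro image_eqI[of _ _ "(i1, i2, j1, j2, l1, l2, \<tau>)"]) auto
    qed
    thus "finite V" by (rule finite_subset) auto
    \<comment> \<open>Different values of i1 and i2 avoid the trivial case even for N = 1, where l1,
      l2 and \<tau> can only be 0.\<close>
    have "F 0 1 0 0 0 0 0 \<in> V" unfolding V_def using N_pos by force
    thus "V \<noteq> {}" by blast
    fix x assume "x \<in> V"
    then obtain i1 i2 j1 j2 l1 l2 \<tau> where x: "x = F i1 i2 j1 j2 l1 l2 \<tau>"
      and *: "i1 \<le> 1" "i2 \<le> 1" "j1 \<le> 1" "j2 \<le> 1" "l1 < N" "l2 < N" "\<tau> < N"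
        "\<not> (\<tau> = 0 \<and> i1 = i2 \<and> j1 = j2 \<and> l1 = l2)"
      unfolding V_def by blast
    show "x \<le> 3 / sqrt 2 * sqrt (real N + 1 / 2) + 1 / 2"
      unfolding x F_def S_seq_def half_period_eq d_eq[symmetric]
      unfolding correlation_eq
      by (rule half_sum_bound[OF coefficients_nonzero[OF *]])
  qed
  finally show ?thesis .
qed

lemma S_family_mem:
  assumes "i \<le> 1" "j \<le> 1" "l < N"
  shows "(\<lambda>t. m_seq p n \<beta> \<alpha> (2 * t + i) + m_seq p n \<beta> \<alpha> (d * (t + l) + j)) \<in> S_family p n \<beta> \<alpha>"
  using assms unfolding S_family_def S_seq_def half_period_eq d_eq[symmetric] by blast

end

theorem theorem7:
  fixes p n N d :: nat and \<alpha> \<beta> :: "'a::{field, finite}"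
  assumes "prime p" and "odd p" and "[p = 3] (mod 4)"
    and "odd n"
    and "card (UNIV :: 'a set) = p ^ n"
    and "N = (p ^ n - 1) div 2"
    and "d = N + 1"
    and "primitive_element \<alpha>"
    and "\<beta> \<noteq> 0"
  shows "(\<forall>i1\<in>{0,1}. \<forall>i2\<in>{0,1}. \<forall>j1\<in>{0,1}. \<forall>j2\<in>{0,1}.
           \<forall>l1\<in>{0..N-1}. \<forall>l2\<in>{0..N-1}. \<forall>\<tau>\<in>{0..N-1}.
             let s1 = (\<lambda>t. m_seq p n \<beta> \<alpha> (2 * t + i1) + m_seq p n \<beta> \<alpha> (d * (t + l1) + j1));
                 s2 = (\<lambda>t. m_seq p n \<beta> \<alpha> (2 * t + i2) + m_seq p n \<beta> \<alpha> (d * (t + l2) + j2));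
                 a = \<beta> * (\<alpha> ^ i1 - \<alpha> ^ (2 * \<tau> + i2));
                 b = \<beta> * (\<alpha> ^ (d * l1 + j1) - \<alpha> ^ (d * \<tau> + d * l2 + j2))
             in s1 \<in> S_family p n \<beta> \<alpha> \<and> s2 \<in> S_family p n \<beta> \<alpha> \<and>
                correlation p N s1 s2 \<tau> =
                  (\<Sum>t<N. omega_pow p (Tr p n (a * \<alpha> ^ (2 * t) + b * \<alpha> ^ ((N + 1) * t)))))
         \<and> C_max p n \<beta> \<alpha> \<le> 3 / sqrt 2 * sqrt (real N + 1 / 2) + 1 / 2"
proof -
  interpret sequence_family p n N d \<alpha> \<beta>
    by unfold_locales (use assms in auto)
  have l: "l < N" if "l \<in> {0..N-1}" for l using that N_pos by auto
  have i: "i \<le> 1" if "i \<in> {0, 1}" for i :: nat using that by auto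
  show ?thesis
    unfolding Let_def
    by (intro conjI ballI C_max_le)
      (simp_all only: S_family_mem i l correlation_eq \<psi>_def)
qed

end
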